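(* As formal power series in $q$ (equivalently, as analytic functions for $|q|<1$), the following two identities hold: $$\sum_{n\ge1}\frac{q^n(q^{2n+1};q^2)_{\infty}}{(1-q^n)^2(q^{n+1};q)_{\infty}}=\frac{1}{(q^2;q^2)_{\infty}}\sum_{n\ge1}\frac{nq^n}{1-q^n}-\frac{1}{2}\sum_{n\ge1}N_2(n)q^{2n},$$ $$\sum_{n\ge1}\frac{q^{n(n+1)/2}(q^{2n+1};q^2)_{\infty}}{(1-q^n)^2(q^{n+1};q)_{\infty}}=\frac{1}{(q^2;q^2)_{\infty}}\sum_{n\ge1}\frac{nq^n}{1-q^n}-\frac{1}{2}\sum_{n\ge1}M_2(n)q^{2n}.$$
   Context: Notation: $(a;q)_n=(1-a)(1-aq)\cdots(1-aq^{n-1})$ and $(a;q)_\infty=\prod_{k\ge0}(1-aq^k)$. The rank of a partition is its largest part minus its number of parts; $N(m,n)$ is the number of partitions of $n$ with rank $m$, and $N_2(n)=\sum_{m\in\mathbb{Z}}m^2N(m,n)$. The crank counts $M(m,n)$ are defined by $\sum_{n\ge0}\sum_{m\in\mathbb{Z}}M(m,n)z^mq^n=\frac{(q;q)_\infty}{(zq;q)_\infty(q/z;q)_\infty}$ (for $n\ge2$, $M(m,n)$ is the number of partitions of $n$ with crank $m$), and $M_2(n)=\sum_{m\in\mathbb{Z}}m^2M(m,n)$. *)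

theory Defs
  imports "HOL-Analysis.Analysis" "HOL-Computational_Algebra.Computational_Algebra"
    "HOL-Library.Multiset"
begin

text \<open>
  The definition is polymorphic because it is used in two rings of formal power series in \<open>q\<close>:
  over the complex numbers, and over the field of formal Laurent series in \<open>z\<close>.  In both cases
  limits are taken in the library's topology on formal power series, in which a sequence converges
  iff each coefficient is eventually constant.
\<close>

definition qpoch_inf :: "'a \<Rightarrow> 'a \<Rightarrow> 'a :: {t2_space, comm_ring_1}" where
  "qpoch_inf a q = (\<Prod>k. 1 - a * q ^ k)"

definition partitions_of :: "nat \<Rightarrow> nat multiset set" where
  "partitions_of n = {P. 0 \<notin># P \<and> sum_mset P = n}"

text \<open>Inserting \<open>0\<close> only affects the empty partition, whose rank is thus \<open>0\<close>.\<close>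

definition partition_rank :: "nat multiset \<Rightarrow> int" where
  "partition_rank P = int (Max (insert 0 (set_mset P))) - int (size P)"

definition rank_count :: "int \<Rightarrow> nat \<Rightarrow> nat" where
  "rank_count m n = card {P \<in> partitions_of n. partition_rank P = m}"

text \<open>Here and in the second crank moment only finitely many \<open>m\<close> contribute.\<close>

definition rank_moment2 :: "nat \<Rightarrow> int" where
  "rank_moment2 n = (\<Sum>\<^sub>\<infinity>m\<in>UNIV. m\<^sup>2 * int (rank_count m n))"

text \<open>
  The variable \<open>z\<close> is \<^const>\<open>fls_X\<close> and \<open>q\<close> is \<^const>\<open>fps_X\<close>.  The coefficients with respect
  to \<open>q\<close> are in fact Laurent polynomials in \<open>z\<close> with integer coefficients; complex Laurent series
  are used so that the division takes place over a field.
\<close>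

definition crank_gf :: "complex fls fps" where
  "crank_gf =
     qpoch_inf fps_X fps_X /
     (qpoch_inf (fps_const fls_X * fps_X) fps_X * qpoch_inf (fps_const fls_X_inv * fps_X) fps_X)"

definition crank_count :: "int \<Rightarrow> nat \<Rightarrow> complex" where
  "crank_count m n = fls_nth (fps_nth crank_gf n) m"

definition crank_moment2 :: "nat \<Rightarrow> complex" where
  "crank_moment2 n = (\<Sum>\<^sub>\<infinity>m\<in>UNIV. of_int (m\<^sup>2) * crank_count m n)"

end

theory Submission
  imports Defs
begin

text \<open>
  Write \<open>(q)\<^sub>n\<close> for the \<open>q\<close>-factorial.  Up to the factor \<open>1 / (q\<^sup>2; q\<^sup>2)\<^sub>\<infinity>\<close> the summands are
  \<open>q\<^sup>n (q)\<^sub>n\<^sub>-\<^sub>1\<^sup>2 \<beta>\<^sub>n\<close>, where \<open>\<beta>\<close> belongs to one of Slater's Bailey pairs C(1) and C(5), that is,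
  \<open>\<beta>\<^sub>n = \<Sum> a\<^sub>r / ((q)\<^sub>n\<^sub>-\<^sub>2\<^sub>r (q)\<^sub>n\<^sub>+\<^sub>2\<^sub>r)\<close>.  Since
  \<open>\<Sum>\<^sub>n q\<^sup>n (q)\<^sub>n\<^sub>-\<^sub>1\<^sup>2 / ((q)\<^sub>n\<^sub>-\<^sub>r (q)\<^sub>n\<^sub>+\<^sub>r) = q\<^sup>r / (1 - q\<^sup>r)\<^sup>2\<close> for \<open>r \<ge> 1\<close>, the sums become
  \<open>\<Sum> n q\<^sup>n / (1 - q\<^sup>n)\<close> plus \<open>\<Sum> a\<^sub>r q\<^sup>2\<^sup>r / (1 - q\<^sup>2\<^sup>r)\<^sup>2\<close>.

  For C(1) the latter sum is the rank moment: Dyson's bijection gives a recurrence for the generating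
  function of the partitions of rank at least \<open>m\<close>, whose solution is a partial theta series divided
  by \<open>(q)\<^sub>\<infinity>\<close>.  For C(5) the unit Bailey pair in base \<open>q\<^sup>2\<close> turns it into
  \<open>- \<Sum> q\<^sup>2\<^sup>k / (1 - q\<^sup>2\<^sup>k)\<^sup>2\<close>, which is the crank moment, obtained by applying \<open>(z d/dz)\<^sup>2\<close> at \<open>z = 1\<close>
  to the product that defines the crank.
\<close>

section \<open>Power series modulo a power of the variable\<close>

text \<open>The weight \<open>q^n (q)_(n-1)^2\<close> comes from Bailey's lemma at
  \<open>a = 1\<close> with both free parameters tending to 1. Each symbol
  \<open>(\<rho>; q)_n\<close> with \<open>n \<ge> 1\<close> then contains a factor
  \<open>1 - \<rho>\<close>. Dividing by the two small factors leaves \<open>(q)_(n-1)^2\<close> on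
  one side and \<open>q^r / (1 - q^r)^2\<close> at index \<open>r \<ge> 1\<close> on the other.
  Index 0 is degenerate: it contributes \<open>\<Sum> q^n / (1 - q^n)^2\<close>, the Lambert series
  in another form, and this is the term common to both identities. The moments come from the indices
  \<open>r \<ge> 1\<close> alone, and they appear at \<open>q^(2n)\<close> because Slater's pairs
  are supported on even indices. Convergence is kept apart from the algebra. Everything is compared
  modulo \<open>X^N\<close> with sums cut off at \<open>N\<close>, so exchanging summations is a
  finite matter, and an equation follows once the congruence holds for every \<open>N\<close>.
  Setting \<open>z = 1\<close> makes no sense for a general Laurent series, so the crank half has to
  carry along the fact that all coefficients are Laurent polynomials.\<close>

definition agree :: "nat \<Rightarrow> 'a::comm_ring_1 fps \<Rightarrow> 'a fps \<Rightarrow> bool" where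
  "agree N f g \<longleftrightarrow> fps_X ^ N dvd f - g"

lemma agree_iff_nth: "agree N f g \<longleftrightarrow> (\<forall>k<N. fps_nth f k = fps_nth g k)"
proof
  assume "agree N f g"
  then obtain h where "f - g = fps_X ^ N * h" by (auto simp: agree_def dvd_def)
  hence "fps_nth (f - g) k = 0" if "k < N" for k using that by (simp add: fps_X_power_mult_nth)
  thus "\<forall>k<N. fps_nth f k = fps_nth g k" by simp
next
  assume *: "\<forall>k<N. fps_nth f k = fps_nth g k"
  have "f - g = fps_X ^ N * fps_shift N (f - g)"
    by (rule fps_ext) (use * in \<open>auto simp: fps_X_power_mult_nth\<close>)
  thus "agree N f g" unfolding agree_def by (metis dvd_triv_left)
qed

lemma agree_refl [simp, intro]: "agree N f f"
  by (simp add: agree_def)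

lemma agree_sym: "agree N f g \<Longrightarrow> agree N g f"
  by (simp add: agree_iff_nth)

lemma agree_trans [trans]: "agree N f g \<Longrightarrow> agree N g h \<Longrightarrow> agree N f h"
  by (simp add: agree_iff_nth)

lemma agree_mono: "agree N f g \<Longrightarrow> M \<le> N \<Longrightarrow> agree M f g"
  by (simp add: agree_iff_nth)

lemma agree_add: "agree N f g \<Longrightarrow> agree N f' g' \<Longrightarrow> agree N (f + f') (g + g')"
  by (simp add: agree_iff_nth)

lemma agree_diff: "agree N f g \<Longrightarrow> agree N f' g' \<Longrightarrow> agree N (f - f') (g - g')"
  by (simp add: agree_iff_nth)

lemma agree_uminus: "agree N f g \<Longrightarrow> agree N (- f) (- g)"
  by (simp add: agree_iff_nth)

lemma agree_mult: "agree N f g \<Longrightarrow> agree N f' g' \<Longrightarrow> agree N (f * f') (g * g')"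
proof -
  assume a: "agree N f g" "agree N f' g'"
  have "f * f' - g * g' = (f - g) * f' + (f' - g') * g" by (simp add: algebra_simps)
  thus ?thesis using a by (simp add: agree_def)
qed

lemma agree_sum: "(\<And>i. i \<in> S \<Longrightarrow> agree N (f i) (g i)) \<Longrightarrow> agree N (sum f S) (sum g S)"
  by (simp add: agree_def sum_subtractf [symmetric] dvd_sum)

lemma agree_power_0:
  assumes "fps_nth q 0 = 0" "N \<le> m"
  shows "agree N (q ^ m) 0"
proof -
  have "agree 1 q 0" using assms by (simp add: agree_iff_nth)
  hence "fps_X dvd q" by (simp add: agree_def)
  hence "fps_X ^ m dvd q ^ m" by (rule dvd_power_same)
  with assms(2) show ?thesis by (auto simp: agree_def intro: dvd_trans le_imp_power_dvd)
qed

lemma agree_mult_cancel: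
  fixes f g u :: "'a::field fps"
  assumes "fps_nth u 0 \<noteq> 0" "agree N (u * f) (u * g)"
  shows "agree N f g"
proof -
  have "inverse u * (u * h) = h" for h
    using assms(1) by (simp add: mult.assoc [symmetric] inverse_mult_eq_1)
  with agree_mult [OF agree_refl assms(2), of "inverse u"] show ?thesis by simp
qed

lemma agree_ext: "(\<And>N. agree N f g) \<Longrightarrow> f = g"
  by (auto simp: agree_iff_nth fps_eq_iff)

text \<open>\<open>f n\<close> starts in degree \<open>n\<close> or later, so coefficient
  \<open>k\<close> of a finite partial sum is final as soon as the indices 1 to \<open>k\<close> are
  included. This is convergence in the topology of formal power series.\<close>

lemma agree_infsum:
  fixes f :: "nat \<Rightarrow> 'a::comm_ring_1 fps"
  assumes "\<And>n. agree n (f n) 0"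
  shows "agree N (\<Sum>\<^sub>\<infinity>n\<in>{1..}. f n) (\<Sum>n=1..N. f n)"
proof -
  define S where "S = Abs_fps (\<lambda>k. fps_nth (\<Sum>n=1..k. f n) k)"
  have nth0: "fps_nth (f n) k = 0" if "k < n" for n k
    using assms [of n] that by (auto simp: agree_iff_nth)
  have S: "fps_nth (sum f F) k = fps_nth S k" if "finite F" "{1..k} \<subseteq> F" "F \<subseteq> {1..}" for F k
  proof -
    have "(\<Sum>n\<in>F. fps_nth (f n) k) = (\<Sum>n\<in>{1..k}. fps_nth (f n) k)"
      using that by (intro sum.mono_neutral_right) (auto intro!: nth0)
    thus ?thesis by (simp add: S_def fps_sum_nth)
  qed
  have "(f has_sum S) {1..}"
    unfolding has_sum_def
  proof (rule tendsto_fpsI)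
    fix k
    show "\<forall>\<^sub>F F in finite_subsets_at_top {1..}. fps_nth (sum f F) k = fps_nth S k"
      unfolding eventually_finite_subsets_at_top
      by (rule exI [of _ "{1..k}"]) (auto intro!: S)
  qed
  hence "(\<Sum>\<^sub>\<infinity>n\<in>{1..}. f n) = S" by (rule infsumI)
  moreover have "fps_nth S k = fps_nth (\<Sum>n=1..N. f n) k" if "k < N" for k
    using that by (intro S [symmetric]) auto
  ultimately show ?thesis by (simp add: agree_iff_nth)
qed

lemma qpoch_inf_agree:
  fixes a q :: "'a::idom fps"
  assumes a: "fps_nth a 0 = 0" and q: "fps_nth q 0 = 0"
  shows "agree N (qpoch_inf a q) (\<Prod>k<N. 1 - a * q ^ k)"
proof -
  define P where "P = (\<lambda>n. \<Prod>k<n. 1 - a * q ^ k)"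
  have step: "agree n (P (Suc m)) (P m)" if "n \<le> m" for n m
  proof -
    have "agree n (P m * (1 - a * q ^ m)) (P m * (1 - a * 0))"
      using that q by (intro agree_mult agree_diff agree_refl agree_power_0) auto
    thus ?thesis by (simp add: P_def)
  qed
  have P: "agree n (P m) (P n)" if "n \<le> m" for n m
    using that by (induction m rule: dec_induct) (auto intro: agree_trans step)
  define S where "S = Abs_fps (\<lambda>k. fps_nth (P (Suc k)) k)"
  have S: "fps_nth (P m) k = fps_nth S k" if "k < m" for m k
    using P [of "Suc k" m] that by (auto simp: agree_iff_nth S_def)
  \<comment> \<open>\<open>has_prod\<close> demands a nonzero limit; the constant term 1 provides
    it.\<close>
  have "fps_nth S 0 = 1" by (simp add: S_def P_def a)
  hence "S \<noteq> 0" by auto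
  moreover have "(\<lambda>n. \<Prod>i\<le>n. 1 - a * q ^ i) \<longlonglongrightarrow> S"
  proof (rule tendsto_fpsI)
    fix k
    have "fps_nth (\<Prod>i\<le>n. 1 - a * q ^ i) k = fps_nth S k" if "n \<ge> k" for n
      using S [of k "Suc n"] that by (simp add: P_def lessThan_Suc_atMost)
    thus "\<forall>\<^sub>F n in sequentially. fps_nth (\<Prod>i\<le>n. 1 - a * q ^ i) k = fps_nth S k"
      by (auto simp: eventually_sequentially)
  qed
  ultimately have "(\<lambda>k. 1 - a * q ^ k) has_prod S"
    by (simp add: has_prod_def raw_has_prod_def)
  hence "qpoch_inf a q = S" unfolding qpoch_inf_def by (rule has_prod_unique [symmetric])
  thus ?thesis using S by (simp add: agree_iff_nth P_def)
qed

section \<open>A limiting case of the Bailey lemma\<close>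

definition qfac :: "'a::field fps \<Rightarrow> nat \<Rightarrow> 'a fps" where
  "qfac q n = (\<Prod>k=1..n. 1 - q ^ k)"

text \<open>
  The reciprocal \<open>q\<close>-factorial, extended by \<open>0\<close> to negative indices.  This makes \<open>qrecip_pred\<close>
  hold for all integers, so that no boundary cases occur in the telescoping sums below.
\<close>

definition qrecip :: "'a::field fps \<Rightarrow> int \<Rightarrow> 'a fps" where
  "qrecip q k = (if k < 0 then 0 else inverse (qfac q (nat k)))"

lemma qfac_0 [simp]: "qfac q 0 = 1"
  by (simp add: qfac_def)

lemma qfac_Suc: "qfac q (Suc n) = (1 - q ^ Suc n) * qfac q n"
  by (simp add: qfac_def mult.commute)

lemma qrecip_neg: "k < 0 \<Longrightarrow> qrecip q k = 0"
  by (simp add: qrecip_def)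

lemma qrecip_0 [simp]: "qrecip q 0 = 1"
  by (simp add: qrecip_def)

locale qbase =
  fixes q :: "'a::field fps"
  assumes q_nth_0 [simp]: "fps_nth q 0 = 0"
begin

lemma one_minus_power_nth_0: "0 < k \<Longrightarrow> fps_nth (1 - q ^ k) 0 = 1"
  by (simp add: fps_power_zeroth_eq_one)

lemma qfac_nth_0: "fps_nth (qfac q n) 0 = 1"
  by (induction n) (simp_all add: qfac_Suc one_minus_power_nth_0 del: power_Suc)

lemma qrecip_pred: "qrecip q (k - 1) = (1 - q ^ nat k) * qrecip q k"
proof (cases "k \<le> 0")
  case True
  thus ?thesis by (auto simp: qrecip_def)
next
  case False
  then obtain m where k: "k = int (Suc m)" by (metis not_le zero_less_imp_eq_int gr0_implies_Suc)
  hence "nat k = Suc m" "nat (k - 1) = m" by auto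
  moreover have "inverse (1 - q ^ Suc m) * (1 - q ^ Suc m) = 1"
    by (intro inverse_mult_eq_1) (subst one_minus_power_nth_0, simp_all)
  hence "inverse (qfac q m) = (1 - q ^ Suc m) * inverse (qfac q (Suc m))"
    unfolding qfac_Suc fps_inverse_mult by (simp add: mult_ac)
  ultimately show ?thesis using False by (simp add: qrecip_def)
qed

text \<open>The factor that multiplies \<open>a_r\<close> when a Bailey pair is inserted into the
  weighted sum over \<open>1 \<le> n \<le> N\<close>, with \<open>n = Suc m\<close>.\<close>

definition bailey_weight :: "nat \<Rightarrow> nat \<Rightarrow> 'a fps" where
  "bailey_weight N r =
     (\<Sum>m<N. q ^ Suc m * (qfac q m)\<^sup>2 * qrecip q (int (Suc m) - int r) * qrecip q (int (Suc m) + int r))"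

text \<open>A first-order recurrence in \<open>r\<close>, obtained because the difference of the two
  summands telescopes in \<open>m\<close> with certificate \<open>G\<close>. The lower end
  contributes \<open>q\<close> only for \<open>r = 0\<close>, and the upper end is divisible by
  \<open>q ^ Suc N\<close>. At \<open>r = 0\<close> the old weight is multiplied by
  \<open>1 - q ^ 0 = 0\<close>, so the recurrence needs no initial value.\<close>

lemma bailey_weight_Suc:
  "(1 - q ^ Suc r)\<^sup>2 * bailey_weight N (Suc r) = q * (1 - q ^ r)\<^sup>2 * bailey_weight N r
     + (if r = 0 then q else 0)
     - (1 - q ^ (2 * r + 1)) * q ^ Suc N * (qfac q N)\<^sup>2 * qrecip q (int N - int r) * qrecip q (int N + 1 + int r)"
proof -
  define G where "G = (\<lambda>m. - (1 - q ^ (2 * r + 1)) * q ^ Suc m * (qfac q m)\<^sup>2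
     * qrecip q (int m - int r) * qrecip q (int m + 1 + int r))"
  define t where "t = (\<lambda>r m. q ^ Suc m * (qfac q m)\<^sup>2 * qrecip q (int (Suc m) - int r) * qrecip q (int (Suc m) + int r))"
  have step: "(1 - q ^ Suc r)\<^sup>2 * t (Suc r) m - q * (1 - q ^ r)\<^sup>2 * t r m = G (Suc m) - G m" for m
  proof -
    define A where "A = qrecip q (int (Suc m) - int r)"
    define B where "B = qrecip q (int (Suc m) + int (Suc r))"
    have e1: "qrecip q (int m - int r) = (1 - q ^ nat (int (Suc m) - int r)) * A"
      using qrecip_pred [of "int (Suc m) - int r"] by (simp add: A_def)
    have e2: "qrecip q (int (Suc m) + int r) = (1 - q ^ (m + r + 2)) * B"
      using qrecip_pred [of "int (Suc m) + int (Suc r)"] by (simp add: B_def nat_add_distrib add.commute add.left_commute)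
    have e3: "int (Suc m) - int (Suc r) = int m - int r" "int m + 1 + int r = int (Suc m) + int r"
       "int (Suc m) + 1 + int r = int (Suc m) + int (Suc r)" by auto
    show ?thesis
    proof (cases "r \<le> Suc m")
      case False
      hence "A = 0" by (simp add: A_def qrecip_neg)
      thus ?thesis unfolding t_def G_def e3 e1 e2 A_def [symmetric] by simp
    next
      case True
      then obtain d where d: "Suc m = r + d" using le_Suc_ex by blast
      hence d': "nat (int (Suc m) - int r) = d" by auto
      \<comment> \<open>After \<open>Suc m = r + d\<close> every power is a monomial in
        \<open>q\<close>, \<open>a\<close> and \<open>b\<close>, which leaves a polynomial identity
        in these, \<open>A\<close>, \<open>B\<close> and \<open>qfac q m\<close>.\<close>
      define a b where "a = q ^ d" and "b = q ^ r"
      have "m + r + 2 = d + r * 2 + 1" "2 * r + 1 = r * 2 + 1" using d by auto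
      hence p: "q ^ (m + r + 2) = a * b\<^sup>2 * q" "q ^ (2 * r + 1) = b\<^sup>2 * q" "q ^ Suc r = q * b"
        "q ^ Suc m = a * b"
        by (simp_all only: a_def b_def power_add power_mult power_one_right power_Suc [of q r] d mult_ac)
      have p': "q ^ Suc (Suc m) = q * (a * b)"
        unfolding power_Suc [of q "Suc m"] \<open>q ^ Suc m = a * b\<close> ..
      show ?thesis
        unfolding t_def G_def e3 e1 e2 A_def [symmetric] B_def [symmetric] d' qfac_Suc p p'
        unfolding a_def [symmetric] b_def [symmetric]
        by algebra
    qed
  qed
  have "(1 - q ^ Suc r)\<^sup>2 * bailey_weight N (Suc r) - q * (1 - q ^ r)\<^sup>2 * bailey_weight N r
      = (\<Sum>m<N. G (Suc m) - G m)"
    unfolding step [symmetric] bailey_weight_def t_def sum_subtractf sum_distrib_left ..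
  also have "\<dots> = G N - G 0" by (rule sum_lessThan_telescope)
  also have "G 0 = - (if r = 0 then q else 0)"
  proof (cases "r = 0")
    case True
    have "(1 - q) * qrecip q 1 = 1" using qrecip_pred [of 1] by simp
    hence "- ((1 - q) * q * qrecip q 1) = - q" by algebra
    moreover have "G 0 = - ((1 - q) * q * qrecip q 1)" using True by (simp add: G_def algebra_simps)
    ultimately show ?thesis using True by simp
  qed (simp add: G_def qrecip_neg)
  finally show ?thesis by (simp add: G_def algebra_simps)
qed

text \<open>Modulo \<open>X ^ Suc N\<close> the boundary term of the recurrence disappears, so each
  step in \<open>r\<close> just multiplies by \<open>q\<close>.\<close>

lemma bailey_weight_agree: "agree (Suc N) ((1 - q ^ Suc r)\<^sup>2 * bailey_weight N (Suc r)) (q ^ Suc r)"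
proof (induction r)
  case 0
  have "agree (Suc N) (q * (1 - q ^ 0)\<^sup>2 * bailey_weight N 0 + q - (1 - q ^ (2 * 0 + 1)) * q ^ Suc N * (qfac q N)\<^sup>2
     * qrecip q (int N - int 0) * qrecip q (int N + 1 + int 0)) (0 + q - (1 - q ^ (2 * 0 + 1)) * 0 * (qfac q N)\<^sup>2
     * qrecip q (int N - int 0) * qrecip q (int N + 1 + int 0))"
    by (intro agree_diff agree_mult agree_add agree_power_0) auto
  thus ?case unfolding bailey_weight_Suc by simp
next
  case (Suc r)
  have "agree (Suc N) (q * (1 - q ^ Suc r)\<^sup>2 * bailey_weight N (Suc r) + 0
     - (1 - q ^ (2 * Suc r + 1)) * q ^ Suc N * (qfac q N)\<^sup>2
     * qrecip q (int N - int (Suc r)) * qrecip q (int N + 1 + int (Suc r)))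
    (q * q ^ Suc r + 0 - (1 - q ^ (2 * Suc r + 1)) * 0 * (qfac q N)\<^sup>2
     * qrecip q (int N - int (Suc r)) * qrecip q (int N + 1 + int (Suc r)))"
    unfolding mult.assoc [of q] using Suc
    by (intro agree_diff agree_mult agree_add agree_power_0) auto
  thus ?case unfolding bailey_weight_Suc [of "Suc r"] by simp
qed

lemma bailey_weight_eq:
  assumes "0 < r"
  shows "agree N (bailey_weight N r) (q ^ r * inverse ((1 - q ^ r)\<^sup>2))"
proof -
  obtain s where r: "r = Suc s" using assms gr0_implies_Suc by blast
  have nz: "fps_nth ((1 - q ^ r)\<^sup>2) 0 = 1"
    using one_minus_power_nth_0 [OF assms] by (simp add: fps_power_zeroth_eq_one)
  show ?thesis
  proof (rule agree_mult_cancel)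
    show "fps_nth ((1 - q ^ r)\<^sup>2) 0 \<noteq> 0" using nz by simp
    have eq: "(1 - q ^ r)\<^sup>2 * (q ^ r * inverse ((1 - q ^ r)\<^sup>2)) = q ^ r"
      using inverse_mult_eq_1 [of "(1 - q ^ r)\<^sup>2"] nz by (simp add: mult.left_commute mult.commute)
    show "agree N ((1 - q ^ r)\<^sup>2 * bailey_weight N r) ((1 - q ^ r)\<^sup>2 * (q ^ r * inverse ((1 - q ^ r)\<^sup>2)))"
      unfolding eq unfolding r by (rule agree_mono [OF bailey_weight_agree]) simp
  qed
qed


text \<open>Insert the pair and exchange two finite sums; only the replacement of
  \<open>bailey_weight\<close> by its limit is a congruence. The isolated term of index 0 gives
  \<open>(q)_(n-1)^2 / (q)_n^2 = 1 / (1 - q^n)^2\<close>. The stride \<open>c\<close> is 2 for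
  Slater's pairs and 1 for the unit pair.\<close>

lemma bailey_pair_sum:
  assumes c: "0 < c"
    and \<beta>: "\<And>n. 0 < n \<Longrightarrow> n \<le> N \<Longrightarrow> \<beta> n = (qrecip q (int n))\<^sup>2
      + (\<Sum>r=1..N. a r * qrecip q (int n - int (c * r)) * qrecip q (int n + int (c * r)))"
  shows "agree N (\<Sum>n=1..N. q ^ n * (qfac q (n - 1))\<^sup>2 * \<beta> n)
    ((\<Sum>n=1..N. q ^ n * inverse ((1 - q ^ n)\<^sup>2))
      + (\<Sum>r=1..N. a r * (q ^ (c * r) * inverse ((1 - q ^ (c * r))\<^sup>2))))"
proof -
  have sq: "(qfac q (n - 1))\<^sup>2 * (qrecip q (int n))\<^sup>2 = inverse ((1 - q ^ n)\<^sup>2)" if "0 < n" for n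
  proof -
    have n: "n = Suc (n - 1)" using that by simp
    have "inverse (qfac q (n - 1)) * qfac q (n - 1) = 1"
      by (intro inverse_mult_eq_1) (simp add: qfac_nth_0)
    moreover have "qrecip q (int n) = inverse (1 - q ^ n) * inverse (qfac q (n - 1))"
      by (subst n) (simp add: qrecip_def qfac_Suc fps_inverse_mult del: power_Suc of_nat_Suc, simp add: that)
    ultimately have "qfac q (n - 1) * qrecip q (int n) = inverse (1 - q ^ n)"
      by (simp add: mult_ac)
    thus ?thesis by (simp add: fps_inverse_power flip: power_mult_distrib)
  qed
  have "(\<Sum>n=1..N. q ^ n * (qfac q (n - 1))\<^sup>2 * \<beta> n)
    = (\<Sum>n=1..N. q ^ n * inverse ((1 - q ^ n)\<^sup>2)
        + (\<Sum>r=1..N. a r * (q ^ n * (qfac q (n - 1))\<^sup>2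
            * qrecip q (int n - int (c * r)) * qrecip q (int n + int (c * r)))))"
    by (intro sum.cong refl)
       (simp add: \<beta> sq [symmetric] distrib_left sum_distrib_left mult_ac)
  also have "\<dots> = (\<Sum>n=1..N. q ^ n * inverse ((1 - q ^ n)\<^sup>2)) + (\<Sum>r=1..N. a r * bailey_weight N (c * r))"
    unfolding sum.distrib bailey_weight_def sum_distrib_left
    by (subst sum.swap) (simp add: sum.atLeast1_atMost_eq del: of_nat_Suc power_Suc of_nat_mult)
  also have "agree N \<dots> ((\<Sum>n=1..N. q ^ n * inverse ((1 - q ^ n)\<^sup>2))
      + (\<Sum>r=1..N. a r * (q ^ (c * r) * inverse ((1 - q ^ (c * r))\<^sup>2))))"
    using c by (intro agree_add agree_refl agree_sum agree_mult bailey_weight_eq) auto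
  finally show ?thesis .
qed


section \<open>Bailey pairs\<close>

text \<open>
  In this and the two other pairs, \<open>g\<close> is a telescoping certificate of Wilf-Zeilberger type.
  The usual term \<open>a\<^sub>0 = 1\<close> is split off, since the formula for \<open>a\<^sub>r\<close> would give \<open>a\<^sub>0 = 2\<close>.
\<close>

lemma unit_bailey_pair:
  assumes "0 < n" "n \<le> M"
  shows "(qrecip q (int n))\<^sup>2 + (\<Sum>r=1..M. (-1) ^ r * q ^ (r * (r - 1) div 2) * (1 + q ^ r)
           * qrecip q (int n - int (1 * r)) * qrecip q (int n + int (1 * r))) = 0"
proof -
  define F where "F = (\<lambda>r. (-1) ^ r * q ^ (r * (r - 1) div 2) * (1 + q ^ r)
           * qrecip q (int n - int (1 * r)) * qrecip q (int n + int (1 * r)))"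
  define g where "g = (\<lambda>r. - ((-1) ^ r * q ^ (r * (r - 1) div 2)
           * qrecip q (int n - int r) * qrecip q (int n - 1 + int r)))"
  \<comment> \<open>The factor \<open>1 - q ^ n\<close> turns the summand into a difference of
    \<open>g\<close>. The upper end vanishes because \<open>n \<le> M\<close>, and the lower end
    \<open>g 1\<close> cancels the isolated term of index 0.\<close>
  have step: "(1 - q ^ n) * F (Suc s) = g (Suc (Suc s)) - g (Suc s)" for s
  proof -
    define r where "r = Suc s"
    define A where "A = qrecip q (int n - int r)"
    define B where "B = qrecip q (int n + int r)"
    define c where "c = q ^ (r * (r - 1) div 2)"
    have tri: "q ^ (Suc r * (Suc r - 1) div 2) = c * q ^ r"
    proof -
      have "Suc r * (Suc r - 1) = r * (r - 1) + 2 * r" unfolding r_def by (simp add: algebra_simps)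
      hence "Suc r * (Suc r - 1) div 2 = r * (r - 1) div 2 + r" by simp
      thus ?thesis by (simp only: c_def power_add)
    qed
    have e: "qrecip q (int n - int (Suc r)) = (1 - q ^ nat (int n - int r)) * A"
      "qrecip q (int n - 1 + int r) = (1 - q ^ (n + r)) * B"
      "int n - 1 + int (Suc r) = int n + int r"
      using qrecip_pred [of "int n - int r"] qrecip_pred [of "int n + int r"]
      by (simp_all add: A_def B_def algebra_simps nat_add_distrib)
    show ?thesis
    proof (cases "r \<le> n")
      case False
      hence "A = 0" by (simp add: A_def qrecip_neg)
      thus ?thesis unfolding F_def g_def r_def [symmetric] e mult_1 A_def [symmetric] by simp
    next
      case True
      then obtain d where d: "n = r + d" using le_Suc_ex by blast
      have d': "nat (int n - int r) = d" using d by simp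
      define a b where "a = q ^ d" and "b = q ^ r"
      have p: "q ^ n = b * a" "q ^ (n + r) = b * a * b"
        unfolding d by (simp_all add: a_def b_def power_add)
      have m: "(-1) ^ Suc r = - ((-1) ^ r :: 'a fps)" by simp
      show ?thesis
        unfolding F_def g_def r_def [symmetric] e mult_1 A_def [symmetric] B_def [symmetric] tri
          c_def [symmetric] d' p m
        unfolding a_def [symmetric] b_def [symmetric] by algebra
    qed
  qed
  have "(1 - q ^ n) * (\<Sum>r=1..M. F r) = (\<Sum>s<M. g (Suc (Suc s)) - g (Suc s))"
    by (simp add: sum_distrib_left step sum.atLeast1_atMost_eq)
  also have "\<dots> = g (Suc M) - g 1"
    using sum_lessThan_telescope [of "\<lambda>s. g (Suc s)" M] by simp
  also have "g (Suc M) = 0" using assms by (simp add: g_def qrecip_neg)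
  also have "g 1 = (1 - q ^ n) * (qrecip q (int n))\<^sup>2"
    using qrecip_pred [of "int n"] by (simp add: g_def power2_eq_square)
  finally have "(1 - q ^ n) * ((qrecip q (int n))\<^sup>2 + (\<Sum>r=1..M. F r)) = 0"
    by (simp add: distrib_left)
  moreover have "1 - q ^ n \<noteq> 0" using one_minus_power_nth_0 [OF assms(1)] by (metis fps_zero_nth zero_neq_one)
  ultimately show ?thesis by (simp add: F_def)
qed

text \<open>The second member of Slater's pair C(1). For C(5) it carries the extra factor
  \<open>q^(n(n-1)/2)\<close>.\<close>

definition slater_beta :: "nat \<Rightarrow> 'a fps" where
  "slater_beta n = inverse (qfac q n * (\<Prod>k<n. 1 - q ^ (2 * k + 1)))"

lemma odd_prod_nth_0: "fps_nth (\<Prod>k<n. 1 - q ^ (2 * k + 1)) 0 = 1"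
proof (induction n)
  case (Suc n)
  thus ?case using one_minus_power_nth_0 [of "2 * n + 1"] by simp
qed simp

text \<open>The leading coefficient has constant term 1 and is invertible, so the recurrence
  determines \<open>b\<close> from \<open>b 0\<close>. It is used with \<open>e n = 1\<close> for
  C(1) and \<open>e n = q ^ n\<close> for C(5). It is asked only for \<open>n < M\<close> because
  the sums in question are cut off at \<open>M\<close>.\<close>

lemma beta_unique:
  assumes "b 0 = 1" and "\<And>n. n < M \<Longrightarrow> (1 - q ^ Suc n) * (1 - q ^ (2 * n + 1)) * b (Suc n) = e n * b n" "n \<le> M"
  shows "b n = (\<Prod>k<n. e k) * slater_beta n"
  using assms(3)
proof (induction n)
  case 0
  thus ?case using assms(1) by (simp add: slater_beta_def)
next
  case (Suc n)
  define D where "D = (1 - q ^ Suc n) * (1 - q ^ (2 * n + 1))"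
  have D: "fps_nth D 0 = 1"
    unfolding D_def fps_mult_nth_0 by (subst (1 2) one_minus_power_nth_0) auto
  have "slater_beta (Suc n) = inverse D * slater_beta n"
    by (simp add: slater_beta_def D_def qfac_Suc fps_inverse_mult mult_ac del: power_Suc)
  moreover have "b (Suc n) = inverse D * (D * b (Suc n))"
    using D by (simp add: mult.assoc [symmetric] inverse_mult_eq_1)
  moreover have "D * b (Suc n) = e n * b n" unfolding D_def using Suc.prems by (intro assms) simp
  ultimately show ?case using Suc by (simp add: mult_ac)
qed

text \<open>With stride two, a step in \<open>r\<close> moves the arguments by 2. At most two
  applications of \<open>qrecip_pred\<close> reduce every reciprocal factorial of the telescoping
  identities to a multiple of \<open>A\<close> or \<open>B\<close>.\<close>

lemma double_step_recips:
  fixes n r :: nat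
  defines "A \<equiv> qrecip q (int (Suc n) - int (2 * r))" and "B \<equiv> qrecip q (int (Suc n) + int (2 * r))"
  shows "qrecip q (int n - int (2 * r)) = (1 - q ^ nat (int (Suc n) - int (2 * r))) * A"
    "qrecip q (int (Suc n) - int (2 * Suc r)) =
       (1 - q ^ nat (int n - int (2 * r))) * ((1 - q ^ nat (int (Suc n) - int (2 * r))) * A)"
    "qrecip q (int n + int (2 * r)) = (1 - q ^ (Suc n + 2 * r)) * B"
    "qrecip q (int n - 1 + int (2 * r)) = (1 - q ^ (n + 2 * r)) * ((1 - q ^ (Suc n + 2 * r)) * B)"
    "int n - 1 + int (2 * Suc r) = int (Suc n) + int (2 * r)"
proof -
  show 1: "qrecip q (int n - int (2 * r)) = (1 - q ^ nat (int (Suc n) - int (2 * r))) * A"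
    using qrecip_pred [of "int (Suc n) - int (2 * r)"] by (simp add: A_def)
  show "qrecip q (int (Suc n) - int (2 * Suc r)) =
       (1 - q ^ nat (int n - int (2 * r))) * ((1 - q ^ nat (int (Suc n) - int (2 * r))) * A)"
    using qrecip_pred [of "int n - int (2 * r)"] unfolding 1 by (simp add: algebra_simps)
  have nat2: "nat (int (Suc n) + int (2 * r)) = Suc n + 2 * r" "nat (int n + int (2 * r)) = n + 2 * r" by auto
  show 2: "qrecip q (int n + int (2 * r)) = (1 - q ^ (Suc n + 2 * r)) * B"
    using qrecip_pred [of "int (Suc n) + int (2 * r)"] unfolding nat2 by (simp add: B_def)
  have "int n + int (2 * r) - 1 = int n - 1 + int (2 * r)" by simp
  thus "qrecip q (int n - 1 + int (2 * r)) = (1 - q ^ (n + 2 * r)) * ((1 - q ^ (Suc n + 2 * r)) * B)"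
    using qrecip_pred [of "int n + int (2 * r)"] unfolding 2 nat2 by (simp only:)
  show "int n - 1 + int (2 * Suc r) = int (Suc n) + int (2 * r)" by simp
qed

text \<open>If the summand obeys a recurrence in \<open>n\<close> up to a difference of
  \<open>g\<close> in \<open>r\<close>, the sum obeys it exactly. As the sum starts at
  \<open>r = 1\<close>, the lower end \<open>g 1\<close> is not zero but has to match the
  contribution of the isolated term of index 0.\<close>

lemma bailey_sum_step:
  fixes a g :: "nat \<Rightarrow> 'a fps"
  defines "F \<equiv> \<lambda>n r. a r * qrecip q (int n - int (2 * r)) * qrecip q (int n + int (2 * r))"
  assumes step: "\<And>s. x * F (Suc n) (Suc s) - e * F n (Suc s) = g (Suc (Suc s)) - g (Suc s)"
    and g: "g (Suc M) = 0" "x * (qrecip q (int (Suc n)))\<^sup>2 - e * (qrecip q (int n))\<^sup>2 = g 1"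
  shows "x * ((qrecip q (int (Suc n)))\<^sup>2 + (\<Sum>r=1..M. F (Suc n) r)) = e * ((qrecip q (int n))\<^sup>2 + (\<Sum>r=1..M. F n r))"
proof -
  have "x * (\<Sum>r=1..M. F (Suc n) r) - e * (\<Sum>r=1..M. F n r) = (\<Sum>s<M. g (Suc (Suc s)) - g (Suc s))"
    by (simp add: sum_distrib_left step [symmetric] sum.atLeast1_atMost_eq sum_subtractf)
  also have "\<dots> = g (Suc M) - g 1"
    using sum_lessThan_telescope [of "\<lambda>s. g (Suc s)" M] by simp
  finally show ?thesis using g by (simp add: algebra_simps)
qed


text \<open>Slater's C(1): telescoping in \<open>r\<close> shows that the left side satisfies the
  recurrence in \<open>n\<close> of \<open>slater_beta\<close>, with ratio
  \<open>e n = 1\<close>.\<close>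

lemma rank_bailey_pair:
  assumes "n \<le> M"
  shows "(qrecip q (int n))\<^sup>2 + (\<Sum>r=1..M. (-1) ^ r * q ^ (r * (3 * r - 1)) * (1 + q ^ (2 * r))
           * qrecip q (int n - int (2 * r)) * qrecip q (int n + int (2 * r))) = slater_beta n"
    (is "?b n = _")
proof -
  have "?b n = (\<Prod>k<n. 1) * slater_beta n"
  proof (rule beta_unique)
    show "?b 0 = 1" using assms by (simp add: qrecip_neg)
    show "n \<le> M" by fact
    fix n assume "n < M"
    define g where "g = (\<lambda>r. - ((-1) ^ r * q ^ Suc n * q ^ (3 * (r * (r - 1)))
           * qrecip q (int (Suc n) - int (2 * r)) * qrecip q (int n - 1 + int (2 * r))))"
    have "(1 - q ^ Suc n) * (1 - q ^ (2 * n + 1)) * ?b (Suc n) = 1 * ?b n"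
    proof (rule bailey_sum_step [where g = g])
      show "g (Suc M) = 0" using \<open>n < M\<close> by (simp add: g_def qrecip_neg)
      have p: "q ^ (2 * n + 1) = q ^ n * q ^ n * q" "q ^ Suc n = q * q ^ n"
        by (simp_all add: mult_2 power_add)
      have m: "int n - 1 + int (2 * 1) = int (Suc n)" "int (Suc n) - int (2 * 1) = int n - 1"
        "q ^ (3 * (1 * (1 - 1))) = 1" by auto
      have e: "qrecip q (int n - 1) = (1 - q ^ n) * qrecip q (int n)"
        "qrecip q (int n) = (1 - q * q ^ n) * qrecip q (int (Suc n))"
        using qrecip_pred [of "int n"] qrecip_pred [of "int (Suc n)"]
        unfolding nat_int power_Suc by simp_all
      show "(1 - q ^ Suc n) * (1 - q ^ (2 * n + 1)) * (qrecip q (int (Suc n)))\<^sup>2 - 1 * (qrecip q (int n))\<^sup>2 = g 1"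
        unfolding g_def m e p by algebra
    next
      fix s
      define r where "r = Suc s"
      define A where "A = qrecip q (int (Suc n) - int (2 * r))"
      define B where "B = qrecip q (int (Suc n) + int (2 * r))"
      define c v where "c = q ^ (3 * (r * (r - 1)))" and "v = q ^ r"
      note e = double_step_recips [of n r, folded A_def B_def]
      have "r * (3 * r - 1) = 3 * (r * (r - 1)) + r * 2"
        "3 * (Suc r * (Suc r - 1)) = 3 * (r * (r - 1)) + r * 6"
        by (simp_all add: r_def algebra_simps)
      hence c: "q ^ (r * (3 * r - 1)) = c * v\<^sup>2" "q ^ (3 * (Suc r * (Suc r - 1))) = c * v ^ 6"
        by (simp_all only: c_def v_def power_add power_mult)
      have v2: "q ^ (2 * r) = v\<^sup>2" by (simp add: v_def power_mult mult.commute)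
      have m: "(-1) ^ Suc r = - ((-1) ^ r :: 'a fps)" by simp
      have "(1 - q ^ Suc n) * (1 - q ^ (2 * n + 1)) * ((-1) ^ r * q ^ (r * (3 * r - 1)) * (1 + q ^ (2 * r))
           * qrecip q (int (Suc n) - int (2 * r)) * qrecip q (int (Suc n) + int (2 * r)))
         - 1 * ((-1) ^ r * q ^ (r * (3 * r - 1)) * (1 + q ^ (2 * r))
           * qrecip q (int n - int (2 * r)) * qrecip q (int n + int (2 * r))) = g (Suc r) - g r"
      \<comment> \<open>In this case \<open>n = 2 r + d\<close>, and all powers are monomials in
        \<open>q\<close>, \<open>v\<close> and \<open>w\<close>.\<close>
      proof (cases "2 * r < Suc n")
        case True
        then obtain d where d: "n = r * 2 + d" by (metis le_Suc_ex less_Suc_eq_le mult.commute)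
        define w where "w = q ^ d"
        have p: "q ^ n = v\<^sup>2 * w" "q ^ (n + 2 * r) = v ^ 4 * w" "q ^ Suc n = q * (v\<^sup>2 * w)"
            "q ^ (Suc n + 2 * r) = q * (v ^ 4 * w)" "q ^ (2 * n + 1) = q * (v ^ 4 * w\<^sup>2)"
            "nat (int n - int (2 * r)) = d" "nat (int (Suc n) - int (2 * r)) = Suc d"
            "q ^ Suc d = q * w"
        proof -
          show "q ^ n = v\<^sup>2 * w" unfolding d v_def w_def by (simp add: power_add power_mult)
          have "n + 2 * r = r * 4 + d" "Suc n + 2 * r = Suc (r * 4 + d)" "2 * n + 1 = Suc (r * 4 + d * 2)" using d by auto
          thus "q ^ (n + 2 * r) = v ^ 4 * w" "q ^ (Suc n + 2 * r) = q * (v ^ 4 * w)" "q ^ (2 * n + 1) = q * (v ^ 4 * w\<^sup>2)"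
            by (simp_all only: v_def w_def power_add power_mult power_Suc)
          show "nat (int n - int (2 * r)) = d" "nat (int (Suc n) - int (2 * r)) = Suc d" using d by auto
          show "q ^ Suc n = q * (v\<^sup>2 * w)" unfolding d v_def w_def by (simp add: power_add power_mult)
        qed (simp add: w_def)
        show ?thesis
          unfolding e g_def A_def [symmetric] B_def [symmetric] c m c_def [symmetric] v2 p
          unfolding w_def [symmetric]
          by algebra
      next
        case False
        show ?thesis
        \<comment> \<open>At the boundary index \<open>n - 2 r = - 1\<close>, so there is no
          \<open>d\<close>, yet \<open>A = 1\<close> does not vanish. The reciprocals with a lowered
          argument vanish instead, through the factor \<open>1 - q ^ 0\<close>.\<close>
        proof (cases "2 * r = Suc n")
          case True
          define y where "y = q ^ (2 * n + 1)"
          have p: "q ^ (n + 2 * r) = y" "q ^ Suc n = v\<^sup>2" 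
            "nat (int (Suc n) - int (2 * r)) = 0" "q ^ 0 = 1"
             "q ^ (Suc n + 2 * r) = v ^ 4"
          proof -
            have "n + 2 * r = 2 * n + 1" "Suc n + 2 * r = r * 4" using True by auto
            thus "q ^ (n + 2 * r) = y" "q ^ (Suc n + 2 * r) = v ^ 4" by (simp_all only: y_def v_def power_mult)
            show "q ^ Suc n = v\<^sup>2" unfolding True [symmetric] v2 ..
          qed (use True in simp_all)
          show ?thesis
            unfolding e g_def A_def [symmetric] B_def [symmetric] c m c_def [symmetric] v2 p
              y_def [symmetric]
            by algebra
        next
          case neq: False
          hence "A = 0" using False by (simp add: A_def qrecip_neg)
          thus ?thesis
            unfolding e g_def A_def [symmetric] B_def [symmetric] by simp
        qed
      qed
      thus "(1 - q ^ Suc n) * (1 - q ^ (2 * n + 1)) * ((-1) ^ Suc s * q ^ (Suc s * (3 * Suc s - 1)) * (1 + q ^ (2 * Suc s))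
           * qrecip q (int (Suc n) - int (2 * Suc s)) * qrecip q (int (Suc n) + int (2 * Suc s)))
         - 1 * ((-1) ^ Suc s * q ^ (Suc s * (3 * Suc s - 1)) * (1 + q ^ (2 * Suc s))
           * qrecip q (int n - int (2 * Suc s)) * qrecip q (int n + int (2 * Suc s))) = g (Suc (Suc s)) - g (Suc s)"
        unfolding r_def .
    qed
    thus "(1 - q ^ Suc n) * (1 - q ^ (2 * n + 1)) * ?b (Suc n) = 1 * ?b n" .
  qed
  thus ?thesis by simp
qed

text \<open>Slater's C(5), by the scheme and the case split of \<open>rank_bailey_pair\<close>. The
  recurrence now has ratio \<open>q ^ n\<close>, and the product of these ratios is the power of
  \<open>q\<close> on the right.\<close>

lemma crank_bailey_pair:
  assumes "n \<le> M"
  shows "(qrecip q (int n))\<^sup>2 + (\<Sum>r=1..M. (-1) ^ r * q ^ (r * (r - 1)) * (1 + q ^ (2 * r))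
           * qrecip q (int n - int (2 * r)) * qrecip q (int n + int (2 * r)))
           = q ^ (n * (n - 1) div 2) * slater_beta n"
    (is "?b n = _")
proof -
  have "?b n = (\<Prod>k<n. q ^ k) * slater_beta n"
  proof (rule beta_unique)
    show "?b 0 = 1" using assms by (simp add: qrecip_neg)
    show "n \<le> M" by fact
    fix n assume "n < M"
    define g where "g = (\<lambda>r. - ((-1) ^ r * q ^ (r * (r - 1))
           * qrecip q (int (Suc n) - int (2 * r)) * qrecip q (int n - 1 + int (2 * r))))"
    have "(1 - q ^ Suc n) * (1 - q ^ (2 * n + 1)) * ?b (Suc n) = q ^ n * ?b n"
    proof (rule bailey_sum_step [where g = g])
      show "g (Suc M) = 0" using \<open>n < M\<close> by (simp add: g_def qrecip_neg)
      have p: "q ^ (2 * n + 1) = q ^ n * q ^ n * q" "q ^ Suc n = q * q ^ n"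
        by (simp_all add: mult_2 power_add)
      have m: "int n - 1 + int (2 * 1) = int (Suc n)" "int (Suc n) - int (2 * 1) = int n - 1"
        "q ^ (1 * (1 - 1)) = 1" by auto
      have e: "qrecip q (int n - 1) = (1 - q ^ n) * qrecip q (int n)"
        "qrecip q (int n) = (1 - q * q ^ n) * qrecip q (int (Suc n))"
        using qrecip_pred [of "int n"] qrecip_pred [of "int (Suc n)"]
        unfolding nat_int power_Suc by simp_all
      show "(1 - q ^ Suc n) * (1 - q ^ (2 * n + 1)) * (qrecip q (int (Suc n)))\<^sup>2 - q ^ n * (qrecip q (int n))\<^sup>2 = g 1"
        unfolding g_def m e p by algebra
    next
      fix s
      define r where "r = Suc s"
      define A where "A = qrecip q (int (Suc n) - int (2 * r))"
      define B where "B = qrecip q (int (Suc n) + int (2 * r))"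
      define c v where "c = q ^ (r * (r - 1))" and "v = q ^ r"
      note e = double_step_recips [of n r, folded A_def B_def]
      have "Suc r * (Suc r - 1) = r * (r - 1) + r * 2"
        by (simp add: r_def algebra_simps)
      hence c: "q ^ (Suc r * (Suc r - 1)) = c * v\<^sup>2"
        by (simp only: c_def v_def power_add power_mult)
      have v2: "q ^ (2 * r) = v\<^sup>2" by (simp add: v_def power_mult mult.commute)
      have m: "(-1) ^ Suc r = - ((-1) ^ r :: 'a fps)" by simp
      have "(1 - q ^ Suc n) * (1 - q ^ (2 * n + 1)) * ((-1) ^ r * q ^ (r * (r - 1)) * (1 + q ^ (2 * r))
           * qrecip q (int (Suc n) - int (2 * r)) * qrecip q (int (Suc n) + int (2 * r)))
         - q ^ n * ((-1) ^ r * q ^ (r * (r - 1)) * (1 + q ^ (2 * r))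
           * qrecip q (int n - int (2 * r)) * qrecip q (int n + int (2 * r))) = g (Suc r) - g r"
      proof (cases "2 * r < Suc n")
        case True
        then obtain d where d: "n = r * 2 + d" by (metis le_Suc_ex less_Suc_eq_le mult.commute)
        define w where "w = q ^ d"
        have p: "q ^ n = v\<^sup>2 * w" "q ^ (n + 2 * r) = v ^ 4 * w" "q ^ Suc n = q * (v\<^sup>2 * w)"
            "q ^ (Suc n + 2 * r) = q * (v ^ 4 * w)" "q ^ (2 * n + 1) = q * (v ^ 4 * w\<^sup>2)"
            "nat (int n - int (2 * r)) = d" "nat (int (Suc n) - int (2 * r)) = Suc d"
            "q ^ Suc d = q * w"
        proof -
          show "q ^ n = v\<^sup>2 * w" unfolding d v_def w_def by (simp add: power_add power_mult)
          have "n + 2 * r = r * 4 + d" "Suc n + 2 * r = Suc (r * 4 + d)" "2 * n + 1 = Suc (r * 4 + d * 2)" using d by auto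
          thus "q ^ (n + 2 * r) = v ^ 4 * w" "q ^ (Suc n + 2 * r) = q * (v ^ 4 * w)" "q ^ (2 * n + 1) = q * (v ^ 4 * w\<^sup>2)"
            by (simp_all only: v_def w_def power_add power_mult power_Suc)
          show "nat (int n - int (2 * r)) = d" "nat (int (Suc n) - int (2 * r)) = Suc d" using d by auto
          show "q ^ Suc n = q * (v\<^sup>2 * w)" unfolding d v_def w_def by (simp add: power_add power_mult)
        qed (simp add: w_def)
        show ?thesis
          unfolding e g_def A_def [symmetric] B_def [symmetric] c m c_def [symmetric] v2 p
          unfolding w_def [symmetric]
          by algebra
      next
        case False
        show ?thesis
        proof (cases "2 * r = Suc n")
          case True
          define y where "y = q ^ (2 * n + 1)"
          have p: "q ^ (n + 2 * r) = y" "q ^ Suc n = v\<^sup>2" 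
            "nat (int (Suc n) - int (2 * r)) = 0" "q ^ 0 = 1"
             "q ^ (Suc n + 2 * r) = v ^ 4"
          proof -
            have "n + 2 * r = 2 * n + 1" "Suc n + 2 * r = r * 4" using True by auto
            thus "q ^ (n + 2 * r) = y" "q ^ (Suc n + 2 * r) = v ^ 4" by (simp_all only: y_def v_def power_mult)
            show "q ^ Suc n = v\<^sup>2" unfolding True [symmetric] v2 ..
          qed (use True in simp_all)
          show ?thesis
            unfolding e g_def A_def [symmetric] B_def [symmetric] c m c_def [symmetric] v2 p
              y_def [symmetric]
            by algebra
        next
          case neq: False
          hence "A = 0" using False by (simp add: A_def qrecip_neg)
          thus ?thesis
            unfolding e g_def A_def [symmetric] B_def [symmetric] by simp
        qed
      qed
      thus "(1 - q ^ Suc n) * (1 - q ^ (2 * n + 1)) * ((-1) ^ Suc s * q ^ (Suc s * (Suc s - 1)) * (1 + q ^ (2 * Suc s))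
           * qrecip q (int (Suc n) - int (2 * Suc s)) * qrecip q (int (Suc n) + int (2 * Suc s)))
         - q ^ n * ((-1) ^ Suc s * q ^ (Suc s * (Suc s - 1)) * (1 + q ^ (2 * Suc s))
           * qrecip q (int n - int (2 * Suc s)) * qrecip q (int n + int (2 * Suc s))) = g (Suc (Suc s)) - g (Suc s)"
        unfolding r_def .
    qed
    thus "(1 - q ^ Suc n) * (1 - q ^ (2 * n + 1)) * ?b (Suc n) = q ^ n * ?b n" .
  qed
  thus ?thesis by (simp add: prod_power_distrib [symmetric] power_sum [symmetric] Sum_Ico_nat lessThan_atLeast0)
qed

end

section \<open>Ranks and Dyson's bijection\<close>

definition partitions_le :: "nat \<Rightarrow> nat \<Rightarrow> nat multiset set" where
  "partitions_le k n = {P \<in> partitions_of n. \<forall>x\<in>#P. x \<le> k}"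

lemma partitions_le_0: "partitions_le 0 n = (if n = 0 then {{#}} else {})"
proof -
  have "P = {#}" if "0 \<notin># P" "\<forall>x\<in>#P. x \<le> 0" for P :: "nat multiset"
    using that by (metis le_zero_eq multiset_nonemptyE)
  hence "partitions_le 0 n \<subseteq> {{#}}" by (auto simp: partitions_le_def partitions_of_def)
  moreover have "{#} \<in> partitions_le 0 n \<longleftrightarrow> n = 0" by (auto simp: partitions_le_def partitions_of_def)
  ultimately show ?thesis by auto
qed

lemma partitions_le_Suc:
  "partitions_le (Suc k) n = partitions_le k n \<union>
     (if Suc k \<le> n then add_mset (Suc k) ` partitions_le (Suc k) (n - Suc k) else {})"
proof (intro equalityI subsetI)
  fix P assume P: "P \<in> partitions_le (Suc k) n"
  show "P \<in> partitions_le k n \<union>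
     (if Suc k \<le> n then add_mset (Suc k) ` partitions_le (Suc k) (n - Suc k) else {})"
  proof (cases "Suc k \<in># P")
    case True
    then obtain P' where P': "P = add_mset (Suc k) P'" by (metis mset_add)
    hence "P' \<in> partitions_le (Suc k) (n - Suc k)" "Suc k \<le> n"
      using P by (auto simp: partitions_le_def partitions_of_def)
    with P' show ?thesis by auto
  next
    case False
    hence "\<forall>x\<in>#P. x \<le> k" using P by (auto simp: partitions_le_def le_Suc_eq)
    thus ?thesis using P by (auto simp: partitions_le_def)
  qed
qed (auto simp: partitions_le_def partitions_of_def le_SucI split: if_splits)

lemma finite_partitions_le: "finite (partitions_le k n)"
proof (induction k arbitrary: n)
  case (Suc k)
  show ?case
  proof (induction n rule: less_induct)
    case (less n)
    show ?case unfolding partitions_le_Suc [of k n] using less Suc by auto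
  qed
qed (simp add: partitions_le_0)

lemma partitions_le_eq: "n \<le> k \<Longrightarrow> partitions_le k n = partitions_of n"
  by (auto simp: partitions_le_def partitions_of_def dest!: multi_member_split)

lemma finite_partitions_of [simp]: "finite (partitions_of n)"
  using finite_partitions_le [of n n] by (simp add: partitions_le_eq)

definition partition_gf :: "'a::field fps" where
  "partition_gf = Abs_fps (\<lambda>n. of_nat (card (partitions_of n)))"

text \<open>Euler's product, cut off: \<open>partitions_le_Suc\<close> contributes one factor
  \<open>1 - X^k\<close> at a time, and parts above \<open>N\<close> cannot occur in a partition of
  a number below \<open>N\<close>.\<close>

lemma qfac_mult_partition_gf: "agree N (qfac fps_X N * partition_gf) (1 :: 'a::field fps)"
proof -
  define p where "p = (\<lambda>k. Abs_fps (\<lambda>n. of_nat (card (partitions_le k n))) :: 'a fps)"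
  have rec: "(1 - fps_X ^ Suc k) * p (Suc k) = p k" for k
  proof -
    have "fps_nth (p (Suc k)) n = fps_nth (p k + fps_X ^ Suc k * p (Suc k)) n" for n
    proof -
      have "card (partitions_le (Suc k) n) = card (partitions_le k n) +
         card (if Suc k \<le> n then add_mset (Suc k) ` partitions_le (Suc k) (n - Suc k) else {})"
        unfolding partitions_le_Suc [of k n]
        by (rule card_Un_disjoint) (auto simp: finite_partitions_le partitions_le_def)
      also have "card (if Suc k \<le> n then add_mset (Suc k) ` partitions_le (Suc k) (n - Suc k) else {})
          = (if Suc k \<le> n then card (partitions_le (Suc k) (n - Suc k)) else 0)"
        by (auto intro!: card_image simp: inj_on_def)
      finally show ?thesis by (auto simp: p_def fps_X_power_mult_nth simp del: power_Suc)
    qed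
    hence "p (Suc k) = p k + fps_X ^ Suc k * p (Suc k)" by (rule fps_ext)
    thus ?thesis by (simp add: algebra_simps)
  qed
  have "qfac fps_X k * p k = 1" for k
  proof (induction k)
    case 0
    show ?case by (rule fps_ext) (simp add: p_def partitions_le_0)
  next
    case (Suc k)
    have "qfac fps_X (Suc k) * p (Suc k) = qfac fps_X k * ((1 - fps_X ^ Suc k) * p (Suc k))"
      unfolding qfac_Suc by (simp only: mult_ac)
    thus ?case unfolding rec Suc .
  qed
  moreover have "agree N (partition_gf) (p N)"
    by (auto simp: agree_iff_nth partition_gf_def p_def partitions_le_eq)
  ultimately show ?thesis by (metis agree_mult agree_refl)
qed

section \<open>The second rank moment as a sum over tails\<close>

lemma partition_rank_bound:
  assumes "P \<in> partitions_of n"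
  shows "\<bar>partition_rank P\<bar> \<le> int n"
proof -
  have "size P \<le> sum_mset P" if "0 \<notin># P" for P :: "nat multiset"
    using that by (induction P) (auto simp: Suc_leI)
  hence 1: "size P \<le> n" using assms by (auto simp: partitions_of_def)
  have "x \<le> n" if "x \<in># P" for x
    using assms that by (auto simp: partitions_of_def dest!: multi_member_split)
  hence "Max (insert 0 (set_mset P)) \<le> n" by (intro Max.boundedI) auto
  with 1 show ?thesis unfolding partition_rank_def by linarith
qed

text \<open>A square is a sum of consecutive odd numbers. This trades the weight \<open>m^2\<close>
  for conditions that the absolute rank be at least \<open>m\<close>, and these are what Dyson's
  bijection can count.\<close>

lemma square_as_odd_sum:
  assumes "\<bar>x\<bar> \<le> int N"
  shows "x\<^sup>2 = (\<Sum>m=1..N. if int m \<le> \<bar>x\<bar> then 2 * int m - 1 else 0)"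
proof -
  have *: "(\<Sum>m=1..k. 2 * int m - 1) = (int k)\<^sup>2" for k
    by (induction k) (simp_all add: power2_eq_square algebra_simps)
  have "(\<Sum>m=1..N. if int m \<le> \<bar>x\<bar> then 2 * int m - 1 else 0) = (\<Sum>m\<in>{m\<in>{1..N}. int m \<le> \<bar>x\<bar>}. 2 * int m - 1)"
    by (rule sum.inter_filter [symmetric]) simp
  also have "{m\<in>{1..N}. int m \<le> \<bar>x\<bar>} = {1..nat \<bar>x\<bar>}" using assms by auto
  also have "(\<Sum>m\<in>{1..nat \<bar>x\<bar>}. 2 * int m - 1) = x\<^sup>2" unfolding * by simp
  finally show ?thesis ..
qed

lemma rank_moment2_eq_sum: "rank_moment2 n = (\<Sum>P\<in>partitions_of n. (partition_rank P)\<^sup>2)"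
proof -
  have bound: "partition_rank P \<in> {-int n..int n}" if "P \<in> partitions_of n" for P
    using partition_rank_bound [OF that] by auto
  have zero: "rank_count m n = 0" if "m \<notin> {-int n..int n}" for m
  proof -
    have "{P \<in> partitions_of n. partition_rank P = m} = {}"
      using bound that by auto
    thus ?thesis unfolding rank_count_def by (simp only: card.empty)
  qed
  have "rank_moment2 n = (\<Sum>\<^sub>\<infinity>m\<in>{-int n..int n}. m\<^sup>2 * int (rank_count m n))"
    unfolding rank_moment2_def by (rule infsum_cong_neutral) (auto simp: zero)
  also have "\<dots> = (\<Sum>m\<in>{-int n..int n}. \<Sum>P\<in>{P \<in> partitions_of n. partition_rank P = m}. (partition_rank P)\<^sup>2)"
    by (simp add: rank_count_def mult.commute)
  also have "\<dots> = (\<Sum>P\<in>partitions_of n. (partition_rank P)\<^sup>2)"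
    using bound by (intro sum.group) auto
  finally show ?thesis .
qed

definition rank_ge_count :: "int \<Rightarrow> nat \<Rightarrow> nat" where
  "rank_ge_count m n = card {P \<in> partitions_of n. partition_rank P \<ge> m}"

definition rank_le_count :: "int \<Rightarrow> nat \<Rightarrow> nat" where
  "rank_le_count m n = card {P \<in> partitions_of n. partition_rank P \<le> m}"

text \<open>One cut-off \<open>N\<close> serves all \<open>n \<le> N\<close>, so modulo
  \<open>X^N\<close> the moment series is a finite combination of the generating functions of the
  tails.\<close>

lemma rank_moment2_eq:
  assumes "n \<le> N"
  shows "rank_moment2 n = (\<Sum>m=1..N. (2 * int m - 1) * int (rank_ge_count (int m) n + rank_le_count (- int m) n))"
proof -
  have "rank_moment2 n = (\<Sum>P\<in>partitions_of n. \<Sum>m=1..N. if int m \<le> \<bar>partition_rank P\<bar> then 2 * int m - 1 else 0)"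
    unfolding rank_moment2_eq_sum using assms
    by (intro sum.cong refl square_as_odd_sum) (use partition_rank_bound in force)
  also have "\<dots> = (\<Sum>m=1..N. \<Sum>P\<in>{P\<in>partitions_of n. int m \<le> \<bar>partition_rank P\<bar>}. 2 * int m - 1)"
    by (subst sum.swap) (intro sum.cong refl sum.inter_filter [symmetric], simp)
  also have "\<dots> = (\<Sum>m=1..N. (2 * int m - 1) * int (rank_ge_count (int m) n + rank_le_count (- int m) n))"
  proof (intro sum.cong refl)
    fix m assume m: "m \<in> {1..N}"
    have "{P\<in>partitions_of n. int m \<le> \<bar>partition_rank P\<bar>}
       = {P\<in>partitions_of n. int m \<le> partition_rank P} \<union> {P\<in>partitions_of n. partition_rank P \<le> - int m}"
      by auto
    moreover have "card \<dots> = rank_ge_count (int m) n + rank_le_count (- int m) n"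
      unfolding rank_ge_count_def rank_le_count_def using m by (intro card_Un_disjoint) auto
    ultimately show "(\<Sum>P\<in>{P\<in>partitions_of n. int m \<le> \<bar>partition_rank P\<bar>}. 2 * int m - 1)
       = (2 * int m - 1) * int (rank_ge_count (int m) n + rank_le_count (- int m) n)"
      by simp
  qed
  finally show ?thesis .
qed

lemma rank_le_count_compl: "rank_le_count (m - 1) n = card (partitions_of n) - rank_ge_count m n"
  and rank_ge_count_compl: "rank_ge_count (m + 1) n = card (partitions_of n) - rank_le_count m n"
proof -
  have "{P \<in> partitions_of n. partition_rank P \<le> m - 1} = partitions_of n - {P \<in> partitions_of n. partition_rank P \<ge> m}"
    "{P \<in> partitions_of n. partition_rank P \<ge> m + 1} = partitions_of n - {P \<in> partitions_of n. partition_rank P \<le> m}"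
    by auto
  thus "rank_le_count (m - 1) n = card (partitions_of n) - rank_ge_count m n"
    "rank_ge_count (m + 1) n = card (partitions_of n) - rank_le_count m n"
    unfolding rank_le_count_def rank_ge_count_def by (simp_all only:) (subst card_Diff_subset; simp)+
qed

text \<open>
  Dyson's map removes the first column, of length \<open>size P\<close>, and adds a row of length \<open>size P + s\<close>.
  It raises the size of the partition by \<open>s\<close>.  The assumption \<open>\<bar>s\<bar> \<ge> 2\<close> below avoids the case
  \<open>s = - 1\<close>, where the empty partition is an exception.
\<close>

definition dyson_map :: "int \<Rightarrow> nat multiset \<Rightarrow> nat multiset" where
  "dyson_map s P = filter_mset (\<lambda>x. x \<noteq> 0) (add_mset (nat (int (size P) + s)) (image_mset (\<lambda>x. x - 1) P))"

text \<open>The largest part \<open>a\<close> is the added row, so the removed column had length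
  \<open>a - s\<close>; the ones restore the parts of size 1 that vanished with that column. For the
  empty partition \<open>a\<close> is 0, and removing it changes nothing.\<close>

definition dyson_inv :: "int \<Rightarrow> nat multiset \<Rightarrow> nat multiset" where
  "dyson_inv s P = (let a = Max (insert 0 (set_mset P)); R = P - {#a#}
     in image_mset Suc R + replicate_mset (nat (int a - s) - size R) 1)"

lemma sum_mset_filter_neq_0: "sum_mset (filter_mset (\<lambda>x. x \<noteq> 0) M) = (sum_mset M :: nat)"
  by (induction M) auto

lemma sum_mset_pred: "0 \<notin># P \<Longrightarrow> sum_mset (image_mset (\<lambda>x. x - 1) P) + size P = (sum_mset P :: nat)"
  by (induction P) auto

lemma image_Suc_filter_pred:
  "0 \<notin># P \<Longrightarrow> image_mset Suc (filter_mset (\<lambda>x. x \<noteq> 0) (image_mset (\<lambda>x. x - 1) P))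
     + replicate_mset (size P - size (filter_mset (\<lambda>x. x \<noteq> 0) (image_mset (\<lambda>x. x - 1) P))) 1 = P"
proof (induction P)
  case (add x P)
  have "size (filter_mset (\<lambda>x. x \<noteq> 0) (image_mset (\<lambda>x. x - 1) P)) \<le> size P"
    by (metis size_filter_mset_lesseq size_image_mset)
  with add show ?case by (cases "x = 1") (auto simp: Suc_diff_le)
qed simp

text \<open>The bound on the rank says that the largest part is at most
  \<open>size P + s + 1\<close>. Hence the added row is at least as long as every shortened part and
  can be recognised as the maximum. The image has at most \<open>size P + 1\<close> parts, which
  gives its rank bound.\<close>

lemma dyson_map_works:
  assumes s: "2 \<le> \<bar>s\<bar>" and P: "P \<in> partitions_of n" "partition_rank P \<le> s + 1"
  shows "dyson_map s P \<in> partitions_of (nat (int n + s)) \<and> partition_rank (dyson_map s P) \<ge> s - 1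
         \<and> dyson_inv s (dyson_map s P) = P" and "0 \<le> int n + s"
proof -
  have P0: "0 \<notin># P" "sum_mset P = n" using P by (auto simp: partitions_of_def)
  define a where "a = nat (int (size P) + s)"
  have mx: "x \<le> Max (insert 0 (set_mset P))" if "x \<in># P" for x using that by simp
  have "0 \<le> int (size P) + s"
  \<comment> \<open>The empty partition has rank 0, hence \<open>s \<ge> - 1\<close>, and
    \<open>2 \<le> \<bar>s\<bar>\<close> leaves only positive \<open>s\<close>. For
    \<open>s = - 1\<close> the new row would have negative length.\<close>
  proof (cases "P = {#}")
    case True
    thus ?thesis using P(2) s by (simp add: partition_rank_def)
  next
    case False
    then obtain x where x: "x \<in># P" by blast
    hence "1 \<le> x" using P0 by (cases x) auto
    thus ?thesis using mx [OF x] P(2) by (simp add: partition_rank_def)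
  qed
  hence a: "int a = int (size P) + s" by (simp add: a_def)
  have le_a: "x - 1 \<le> a" if "x \<in># P" for x
    using mx [OF that] P(2) a unfolding partition_rank_def by linarith
  define R where "R = filter_mset (\<lambda>x. x \<noteq> 0) (image_mset (\<lambda>x. x - 1) P)"
  have R_le: "x \<le> a" if "x \<in># R" for x using that le_a by (auto simp: R_def)
  have D: "dyson_map s P = (if a = 0 then R else add_mset a R)"
    by (simp add: dyson_map_def R_def a_def)
  have R_empty: "R = {#}" if "a = 0"
    using R_le that by (metis (mono_tags, lifting) R_def filter_mset_eq_conv le_zero_eq multiset_nonemptyE)
  have sumD: "int (sum_mset (dyson_map s P)) = int n + s"
  proof -
    have "sum_mset (dyson_map s P) = a + sum_mset (image_mset (\<lambda>x. x - 1) P)"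
      unfolding dyson_map_def sum_mset_filter_neq_0 by (simp add: a_def)
    with sum_mset_pred [OF P0(1)] P0(2) a show ?thesis by linarith
  qed
  thus "0 \<le> int n + s" by linarith
  have Dp: "dyson_map s P \<in> partitions_of (nat (int n + s))"
  proof -
    have "0 \<notin># dyson_map s P" by (simp add: dyson_map_def)
    moreover have "sum_mset (dyson_map s P) = nat (int n + s)" using sumD by linarith
    ultimately show ?thesis by (simp add: partitions_of_def)
  qed
  have maxD: "Max (insert 0 (set_mset (dyson_map s P))) = a"
    using R_le R_empty by (intro Max_eqI) (auto simp: D split: if_splits)
  have "size R \<le> size P"
    unfolding R_def by (metis size_filter_mset_lesseq size_image_mset)
  hence "size (dyson_map s P) \<le> size P + 1" by (simp add: D)
  hence Dr: "partition_rank (dyson_map s P) \<ge> s - 1" unfolding partition_rank_def maxD using a by linarith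
  have "dyson_map s P - {#a#} = R" using R_empty by (auto simp: D)
  moreover have "nat (int a - s) = size P" using a by simp
  ultimately have "dyson_inv s (dyson_map s P) = P"
    using image_Suc_filter_pred [OF P0(1)] unfolding dyson_inv_def maxD Let_def R_def by simp
  with Dp Dr show "dyson_map s P \<in> partitions_of (nat (int n + s)) \<and> partition_rank (dyson_map s P) \<ge> s - 1
         \<and> dyson_inv s (dyson_map s P) = P" by blast
qed

lemma dyson_inv_works:
  assumes s: "2 \<le> \<bar>s\<bar>" and n: "0 \<le> int n + s"
    and P: "P \<in> partitions_of (nat (int n + s))" "partition_rank P \<ge> s - 1"
  shows "dyson_inv s P \<in> partitions_of n \<and> partition_rank (dyson_inv s P) \<le> s + 1
         \<and> dyson_map s (dyson_inv s P) = P"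
proof -
  have P0: "0 \<notin># P" "int (sum_mset P) = int n + s" using P n by (auto simp: partitions_of_def)
  define a where "a = Max (insert 0 (set_mset P))"
  define R where "R = P - {#a#}"
  have aP: "(P = {#} \<and> a = 0 \<and> R = {#}) \<or> (a \<noteq> 0 \<and> P = add_mset a R)"
  proof (cases "P = {#}")
    case False
    have "a \<in> insert 0 (set_mset P)" unfolding a_def by (intro Max_in) auto
    moreover have "a \<noteq> 0"
    proof -
      obtain x where x: "x \<in># P" using False by blast
      hence "x \<le> a" by (simp add: a_def)
      moreover have "x \<noteq> 0" using x P0(1) by metis
      ultimately show ?thesis by simp
    qed
    ultimately show ?thesis by (simp add: R_def)
  qed (simp add: a_def R_def)
  have R_le: "x \<le> a" if "x \<in># R" for x
    using that unfolding R_def a_def by (intro Max_ge) (auto dest: in_diffD)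
  have rank: "partition_rank P = int a - int (size P)" by (simp add: partition_rank_def a_def)
  \<comment> \<open>The restored column is at least as long as the number of rows in
    \<open>R\<close>, so the subtraction in \<open>t\<close> is not truncated. For empty
    \<open>P\<close> the rank 0 gives \<open>s \<le> 1\<close>, and
    \<open>2 \<le> \<bar>s\<bar>\<close> makes \<open>s\<close> negative.\<close>
  have l: "int (size R) \<le> int a - s"
    using aP
  proof
    assume "P = {#} \<and> a = 0 \<and> R = {#}"
    thus ?thesis using rank P(2) s by auto
  next
    assume "a \<noteq> 0 \<and> P = add_mset a R"
    hence "size P = Suc (size R)" by simp
    thus ?thesis using rank P(2) by linarith
  qed
  define t where "t = nat (int a - s) - size R"
  have t: "int t = int a - s - int (size R)" using l by (simp add: t_def)
  have I: "dyson_inv s P = image_mset Suc R + replicate_mset t 1"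
    by (simp add: dyson_inv_def a_def [symmetric] R_def [symmetric] t_def Let_def)
  have size: "int (size (dyson_inv s P)) = int a - s" using t by (simp add: I)
  have sum_Suc: "sum_mset (image_mset Suc M) = sum_mset M + size M" for M
    by (induction M) auto
  have "int (sum_mset P) = int a + int (sum_mset R)" using aP by auto
  moreover have "sum_mset (dyson_inv s P) = sum_mset R + size R + t" by (simp add: I sum_Suc)
  ultimately have "sum_mset (dyson_inv s P) = n" using t P0(2) by linarith
  hence 1: "dyson_inv s P \<in> partitions_of n" by (auto simp: partitions_of_def I)
  have "Max (insert 0 (set_mset (dyson_inv s P))) \<le> Suc a"
  proof (intro Max.boundedI)
    fix x assume "x \<in> insert 0 (set_mset (dyson_inv s P))"
    hence "x = 0 \<or> x = 1 \<or> x \<in> Suc ` set_mset R"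
      unfolding I by (cases "t = 0") auto
    thus "x \<le> Suc a" using R_le by fastforce
  qed auto
  hence 2: "partition_rank (dyson_inv s P) \<le> s + 1" unfolding partition_rank_def size by linarith
  have z: "0 \<notin># R" using P0(1) by (auto simp: R_def dest: in_diffD)
  hence fR: "filter_mset (\<lambda>x. x \<noteq> 0) R = R" by (intro multiset_eqI) (simp add: not_in_iff)
  have f0: "filter_mset (\<lambda>x. x \<noteq> 0) (replicate_mset t (0::nat)) = {#}"
    by (rule multiset_eqI) simp
  have a: "nat (int (size (dyson_inv s P)) + s) = a" unfolding size by simp
  have "image_mset (\<lambda>x. x - 1) (dyson_inv s P) = R + replicate_mset t 0"
    unfolding I by (simp add: image_mset.compositionality comp_def)
  hence "dyson_map s (dyson_inv s P) = filter_mset (\<lambda>x. x \<noteq> 0) (add_mset a (R + replicate_mset t 0))"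
    unfolding dyson_map_def a by (rule arg_cong)
  also have "\<dots> = (if a \<noteq> 0 then add_mset a R else R)"
    by (simp only: filter_mset_add_mset filter_union_mset fR f0 add_0_right)
  also have "\<dots> = P" using aP by (elim disjE) simp_all
  finally have "dyson_map s (dyson_inv s P) = P" .
  with 1 2 show ?thesis by blast
qed

lemma dyson_count:
  assumes "2 \<le> \<bar>s\<bar>"
  shows "rank_le_count (s + 1) n = (if 0 \<le> int n + s then rank_ge_count (s - 1) (nat (int n + s)) else 0)"
proof (cases "0 \<le> int n + s")
  case True
  have "bij_betw (dyson_map s) {P \<in> partitions_of n. partition_rank P \<le> s + 1}
     {P \<in> partitions_of (nat (int n + s)). partition_rank P \<ge> s - 1}"
    by (rule bij_betw_byWitness [where f' = "dyson_inv s"])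
       (use dyson_map_works [OF assms] dyson_inv_works [OF assms True] in blast)+
  thus ?thesis using True by (simp add: rank_le_count_def rank_ge_count_def bij_betw_same_card)
next
  case False
  hence "{P \<in> partitions_of n. partition_rank P \<le> s + 1} = {}"
    using dyson_map_works(2) [OF assms, of _ n] by blast
  hence "rank_le_count (s + 1) n = 0" unfolding rank_le_count_def by (simp only: card.empty)
  thus ?thesis using False by simp
qed

section \<open>Generating functions of the rank tails\<close>

definition rank_ge_gf :: "nat \<Rightarrow> 'a::field fps" where
  "rank_ge_gf m = Abs_fps (\<lambda>n. of_nat (rank_ge_count (int m) n))"

definition rank_le_gf :: "nat \<Rightarrow> 'a::field fps" where
  "rank_le_gf m = Abs_fps (\<lambda>n. of_nat (rank_le_count (- int m) n))"

lemma count_le_card: "rank_ge_count m n \<le> card (partitions_of n)" "rank_le_count m n \<le> card (partitions_of n)"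
  by (auto simp: rank_ge_count_def rank_le_count_def intro!: card_mono)

text \<open>Dyson's bijection with \<open>s = Suc m\<close> matches rank at least \<open>m\<close>
  for \<open>n\<close> with rank at most \<open>m + 2\<close> for \<open>n - m - 1\<close>, and the
  complement of the latter is rank at least \<open>m + 3\<close>. Positivity of \<open>m\<close>
  gives \<open>s \<ge> 2\<close>.\<close>

lemma rank_ge_gf_rec:
  assumes "0 < m"
  shows "rank_ge_gf m = fps_X ^ Suc m * (partition_gf - rank_ge_gf (m + 3) :: 'a::field fps)"
proof (rule fps_ext)
  fix n
  show "fps_nth (rank_ge_gf m) n = fps_nth (fps_X ^ Suc m * (partition_gf - rank_ge_gf (m + 3) :: 'a fps)) n"
  \<comment> \<open>The bijection has no source of negative size, so low degrees are treated
    directly: a rank of at least \<open>m > 0\<close> forces a part of size at least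
    \<open>m + 1\<close>.\<close>
  proof (cases "n < Suc m")
    case True
    have "{P \<in> partitions_of n. partition_rank P \<ge> int m} = {}"
    proof (safe, simp_all)
      fix P assume P: "P \<in> partitions_of n" "int m \<le> partition_rank P"
      hence "P \<noteq> {#}" using assms by (auto simp: partition_rank_def)
      hence "0 < size P" by (simp add: nonempty_has_size)
      moreover have "x \<le> n" if "x \<in># P" for x
        using P(1) that by (auto simp: partitions_of_def dest!: multi_member_split)
      hence "Max (insert 0 (set_mset P)) \<le> n" by (intro Max.boundedI) auto
      ultimately show False using P(2) True unfolding partition_rank_def by linarith
    qed
    hence "rank_ge_count (int m) n = 0" unfolding rank_ge_count_def by (simp only: card.empty)
    thus ?thesis using True by (simp add: rank_ge_gf_def fps_X_power_mult_nth del: power_Suc)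
  next
    case False
    have "rank_le_count (int (Suc m) + 1) (n - Suc m) = rank_ge_count (int m) n"
      using dyson_count [of "int (Suc m)" "n - Suc m"] assms False by (simp add: nat_diff_distrib of_nat_diff)
    hence "rank_ge_count (int m) n = card (partitions_of (n - Suc m)) - rank_ge_count (int m + 3) (n - Suc m)"
      using rank_le_count_compl [of "int m + 3" "n - Suc m"] by (simp add: add.commute)
    thus ?thesis using False count_le_card(1) [of "int m + 3" "n - Suc m"]
      by (simp add: rank_ge_gf_def partition_gf_def fps_X_power_mult_nth of_nat_diff add.commute del: power_Suc)
  qed
qed

text \<open>The shift \<open>s = - Suc m\<close> leads to the same recurrence as in
  \<open>rank_ge_gf_rec\<close>, so both tails have the same series. This reflects the symmetry of
  the rank under conjugation.\<close>

lemma rank_le_gf_rec: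
  assumes "0 < m"
  shows "rank_le_gf m = fps_X ^ Suc m * (partition_gf - rank_le_gf (m + 3) :: 'a::field fps)"
proof (rule fps_ext)
  fix n
  have *: "rank_le_count (- int m) n = (if Suc m \<le> n then rank_ge_count (- int m - 2) (n - Suc m) else 0)"
  proof -
    have e: "- int (Suc m) + 1 = - int m" "- int (Suc m) - 1 = - int m - 2"
      "nat (int n + - int (Suc m)) = n - Suc m" "0 \<le> int n + - int (Suc m) \<longleftrightarrow> Suc m \<le> n" by auto
    show ?thesis using dyson_count [of "- int (Suc m)" n] assms unfolding e by simp
  qed
  have e: "- int m - 2 = (- int m - 3) + 1" "- int (m + 3) = - int m - 3" by auto
  show "fps_nth (rank_le_gf m) n = fps_nth (fps_X ^ Suc m * (partition_gf - rank_le_gf (m + 3) :: 'a fps)) n"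
    unfolding rank_le_gf_def partition_gf_def fps_X_power_mult_nth fps_sub_nth fps_nth_Abs_fps * e
      rank_ge_count_compl
    using count_le_card(2) [of "- int m - 3" "n - Suc m"] by (simp add: of_nat_diff)
qed

text \<open>The pentagonal numbers. Unrolling the recurrence \<open>n\<close> times multiplies
  powers with exponents \<open>m + 3 k + 1\<close> for \<open>k < n\<close>, whose total is
  \<open>n m + n (3 n - 1) / 2\<close>.\<close>

definition rank_exponent :: "nat \<Rightarrow> nat" where
  "rank_exponent n = n * (3 * n - 1) div 2"

lemma rank_exponent_double: "2 * rank_exponent n = n * (3 * n - 1)"
proof -
  have "even (n * (3 * n - 1))" by (cases "even n") auto
  thus ?thesis unfolding rank_exponent_def by simp
qed

lemma rank_exponent_Suc: "rank_exponent (Suc n) = rank_exponent n + 3 * n + 1"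
proof -
  have "2 * rank_exponent (Suc n) = 2 * (rank_exponent n + 3 * n + 1)"
    unfolding rank_exponent_double distrib_left
    by (cases n) (simp_all add: algebra_simps)
  thus ?thesis by simp
qed

text \<open>Each unrolling replaces \<open>H m\<close> by \<open>H (m + 3)\<close> with a change of
  sign. After \<open>N\<close> rounds the remainder carries a power of exponent at least
  \<open>N m\<close> and vanishes modulo \<open>X^N\<close>, leaving \<open>p\<close> times a
  partial theta series.\<close>

lemma rank_tail_series:
  fixes H :: "nat \<Rightarrow> 'a::field fps"
  assumes rec: "\<And>m. 0 < m \<Longrightarrow> H m = fps_X ^ Suc m * (p - H (m + 3))" and "0 < m"
  shows "agree N (H m) (p * (\<Sum>n=1..N. - ((-1) ^ n * fps_X ^ (rank_exponent n + n * m))))"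
proof -
  have eq: "H m = p * (\<Sum>n=1..K. - ((-1) ^ n * fps_X ^ (rank_exponent n + n * m)))
      + (-1) ^ K * fps_X ^ (rank_exponent K + K * m) * H (m + 3 * K)" for K
  proof (induction K)
    case 0
    show ?case by (simp add: rank_exponent_def)
  next
    case (Suc K)
    define y z :: "'a fps" where "y = fps_X ^ (rank_exponent K + K * m)" and "z = fps_X ^ Suc (m + 3 * K)"
    have e1: "fps_X ^ (rank_exponent (Suc K) + Suc K * m) = y * z"
      unfolding y_def z_def power_add [symmetric] rank_exponent_Suc by (simp add: algebra_simps)
    have e2: "H (m + 3 * K) = z * (p - H (m + 3 * Suc K))"
      using rec [of "m + 3 * K"] \<open>0 < m\<close> by (simp add: z_def algebra_simps)
    have e3: "(\<Sum>n=1..Suc K. - ((-1) ^ n * fps_X ^ (rank_exponent n + n * m))) =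
      (\<Sum>n=1..K. - ((-1) ^ n * fps_X ^ (rank_exponent n + n * m))) - (-1) ^ Suc K * (y * z)"
      by (simp add: e1 [simplified])
    show ?case
      unfolding e3 e1 by (subst Suc, unfold e2 y_def [symmetric]) (simp add: algebra_simps)
  qed
  have "agree N (H m) (p * (\<Sum>n=1..N. - ((-1) ^ n * fps_X ^ (rank_exponent n + n * m)))
      + (-1) ^ N * 0 * H (m + 3 * N))"
    by (subst eq [of N], intro agree_add agree_mult agree_refl agree_power_0)
       (use \<open>0 < m\<close> in \<open>auto simp: trans_le_add2\<close>)
  thus ?thesis by simp
qed


text \<open>The truncation of \<open>\<Sum> (2 m - 1) y^m = y (1 + y) / (1 - y)^2\<close> at
  \<open>y = X^n\<close>; it sums the odd weights introduced by
  \<open>square_as_odd_sum\<close>.\<close>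

lemma odd_weighted_geometric:
  assumes "0 < n"
  shows "agree N (\<Sum>m=1..N. of_int (2 * int m - 1) * fps_X ^ (n * m))
    (fps_X ^ n * (1 + fps_X ^ n) * inverse ((1 - fps_X ^ n)\<^sup>2) :: 'a::field fps)"
proof -
  define y :: "'a fps" where "y = fps_X ^ n"
  have y0: "fps_nth y 0 = 0" using assms by (simp add: y_def)
  have nz: "fps_nth ((1 - y)\<^sup>2) 0 = 1" using y0 by (simp add: fps_power_zeroth_eq_one)
  have eq: "(1 - y)\<^sup>2 * (\<Sum>m=1..k. of_int (2 * int m - 1) * y ^ m)
     = y * (1 + y) - of_int (2 * int k + 1) * y ^ Suc k + of_int (2 * int k - 1) * y ^ (k + 2)" for k
    by (induction k) (simp_all add: algebra_simps power2_eq_square)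
  show ?thesis
  proof (rule agree_mult_cancel)
    show "fps_nth ((1 - y)\<^sup>2) 0 \<noteq> 0" using nz by simp
    have "(1 - y)\<^sup>2 * (\<Sum>m=1..N. of_int (2 * int m - 1) * fps_X ^ (n * m))
      = y * (1 + y) - of_int (2 * int N + 1) * y ^ Suc N + of_int (2 * int N - 1) * y ^ (N + 2)"
      unfolding eq [symmetric] by (simp add: y_def power_mult)
    also have "agree N \<dots> (y * (1 + y) - of_int (2 * int N + 1) * 0 + of_int (2 * int N - 1) * 0)"
      using y0 by (intro agree_add agree_diff agree_mult agree_refl agree_power_0) auto
    also have "y * (1 + y) - of_int (2 * int N + 1) * 0 + of_int (2 * int N - 1) * 0
      = (1 - y)\<^sup>2 * inverse ((1 - y)\<^sup>2) * (y * (1 + y))"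
      using nz by (simp add: inverse_mult_eq_1')
    also have "\<dots> = (1 - y)\<^sup>2 * (fps_X ^ n * (1 + fps_X ^ n) * inverse ((1 - fps_X ^ n)\<^sup>2))"
      by (simp add: y_def mult_ac)
    finally show "agree N ((1 - y)\<^sup>2 * (\<Sum>m=1..N. of_int (2 * int m - 1) * fps_X ^ (n * m)))
       ((1 - y)\<^sup>2 * (fps_X ^ n * (1 + fps_X ^ n) * inverse ((1 - fps_X ^ n)\<^sup>2)))" .
  qed
qed

text \<open>Exchanging the sums over \<open>m\<close> and \<open>n\<close> allows the odd weights to
  be summed in closed form. The factor 2 accounts for the two tails, and \<open>qfac\<close> cancels
  the partition series.\<close>

lemma rank_moment2_gf:
  "agree N (qfac fps_X N * Abs_fps (\<lambda>n. of_int (rank_moment2 n)))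
    (2 * (\<Sum>n=1..N. - ((-1) ^ n * (fps_X ^ (rank_exponent n + n) * (1 + fps_X ^ n)
        * inverse ((1 - fps_X ^ n)\<^sup>2)))) :: 'a::field fps)"
proof -
  let ?E = "qfac fps_X N :: 'a fps" and ?p = "partition_gf :: 'a fps"
  let ?c = "\<lambda>m. of_int (2 * int m - 1) :: 'a fps"
  let ?t = "\<lambda>n. fps_X ^ n * (1 + fps_X ^ n) * inverse ((1 - fps_X ^ n)\<^sup>2) :: 'a fps"
  let ?T = "\<lambda>m. \<Sum>n=1..N. - ((-1) ^ n * fps_X ^ (rank_exponent n + n * m)) :: 'a fps"
  have "agree N (Abs_fps (\<lambda>n. of_int (rank_moment2 n))) (\<Sum>m=1..N. ?c m * (rank_ge_gf m + rank_le_gf m))"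
    unfolding agree_iff_nth
  proof (intro allI impI)
    fix k assume "k < N"
    hence "of_int (rank_moment2 k) = (\<Sum>m=1..N. of_int (2 * int m - 1)
        * (of_nat (rank_ge_count (int m) k) + of_nat (rank_le_count (- int m) k)) :: 'a)"
      by (simp add: rank_moment2_eq [of k N])
    thus "fps_nth (Abs_fps (\<lambda>n. of_int (rank_moment2 n))) k = fps_nth (\<Sum>m=1..N. ?c m * (rank_ge_gf m + rank_le_gf m)) k"
      by (simp add: fps_sum_nth rank_ge_gf_def rank_le_gf_def fps_of_int [symmetric] del: of_int_diff of_int_mult)
  qed
  also have "agree N \<dots> (\<Sum>m=1..N. ?c m * (?p * ?T m + ?p * ?T m))"
    by (intro agree_sum agree_mult agree_add agree_refl rank_tail_series rank_ge_gf_rec rank_le_gf_rec) auto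
  also have "\<dots> = (\<Sum>m=1..N. \<Sum>n=1..N. 2 * ?p * (- ((-1) ^ n * fps_X ^ rank_exponent n * (?c m * fps_X ^ (n * m)))))"
    unfolding mult_2 [symmetric] sum_distrib_left
    by (intro sum.cong refl) (simp only: power_add mult_minus_right mult_ac)
  also have "\<dots> = 2 * ?p * (\<Sum>n=1..N. \<Sum>m=1..N. - ((-1) ^ n * fps_X ^ rank_exponent n * (?c m * fps_X ^ (n * m))))"
    by (subst sum.swap) (simp only: sum_distrib_left)
  also have "\<dots> = 2 * ?p * (\<Sum>n=1..N. - ((-1) ^ n * fps_X ^ rank_exponent n * (\<Sum>m=1..N. ?c m * fps_X ^ (n * m))))"
    by (simp only: sum_negf sum_distrib_left)
  also have "agree N \<dots> (2 * ?p * (\<Sum>n=1..N. - ((-1) ^ n * fps_X ^ rank_exponent n * ?t n)))"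
    by (intro agree_mult agree_sum agree_uminus agree_refl odd_weighted_geometric) auto
  finally have 1: "agree N (Abs_fps (\<lambda>n. of_int (rank_moment2 n)))
     (2 * ?p * (\<Sum>n=1..N. - ((-1) ^ n * fps_X ^ rank_exponent n * ?t n)))" .
  define S where "S = (\<Sum>n=1..N. - ((-1) ^ n * (fps_X ^ (rank_exponent n + n) * (1 + fps_X ^ n)
        * inverse ((1 - fps_X ^ n)\<^sup>2))) :: 'a fps)"
  have S: "(\<Sum>n=1..N. - ((-1) ^ n * fps_X ^ rank_exponent n * ?t n)) = S"
    unfolding S_def by (intro sum.cong refl) (simp only: power_add mult.assoc)
  have "agree N (?E * Abs_fps (\<lambda>n. of_int (rank_moment2 n))) (?E * (2 * ?p * S))"
    using 1 unfolding S by (intro agree_mult agree_refl)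
  also have "?E * (2 * ?p * S) = (?E * ?p) * (2 * S)" by algebra
  also have "agree N \<dots> (1 * (2 * S))"
    by (intro agree_mult agree_refl qfac_mult_partition_gf)
  finally show ?thesis by (simp only: S_def mult_1)
qed

section \<open>Moments of the crank\<close>

definition laurent_poly :: "'a::zero fls \<Rightarrow> bool" where
  "laurent_poly f \<longleftrightarrow> finite {m. fls_nth f m \<noteq> 0}"

text \<open>Evaluation at \<open>z = 1\<close>. For infinite support the sum has the default value
  0, so additivity and multiplicativity are stated under \<open>laurent_poly\<close>.\<close>

definition eval_one :: "'a::comm_monoid_add fls \<Rightarrow> 'a" where
  "eval_one f = (\<Sum>m | fls_nth f m \<noteq> 0. fls_nth f m)"

lemma eval_one_eq:
  "finite T \<Longrightarrow> (\<And>m. m \<notin> T \<Longrightarrow> fls_nth f m = 0) \<Longrightarrow> eval_one f = (\<Sum>m\<in>T. fls_nth f m)"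
  unfolding eval_one_def by (rule sum.mono_neutral_left) auto

lemma laurent_poly_add: "laurent_poly f \<Longrightarrow> laurent_poly g \<Longrightarrow> laurent_poly (f + g)"
  for f g :: "'a::comm_ring_1 fls"
  unfolding laurent_poly_def
  by (rule finite_subset [where B = "{m. fls_nth f m \<noteq> 0} \<union> {m. fls_nth g m \<noteq> 0}"]) auto

lemma eval_one_add:
  fixes f g :: "'a::comm_ring_1 fls"
  assumes "laurent_poly f" "laurent_poly g"
  shows "eval_one (f + g) = eval_one f + eval_one g"
proof -
  let ?T = "{m. fls_nth f m \<noteq> 0} \<union> {m. fls_nth g m \<noteq> 0}"
  have "finite ?T" using assms by (simp add: laurent_poly_def)
  hence "eval_one h = (\<Sum>m\<in>?T. fls_nth h m)" if "h \<in> {f, g, f + g}" for h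
    using that by (intro eval_one_eq) auto
  thus ?thesis by (simp add: sum.distrib)
qed

lemma laurent_poly_const_mult: "laurent_poly f \<Longrightarrow> laurent_poly (fls_const c * f)"
  for f :: "'a::comm_ring_1 fls"
  unfolding laurent_poly_def by (erule finite_subset [rotated]) auto

lemma eval_one_const_mult: 
  fixes f :: "'a::comm_ring_1 fls"
  assumes "laurent_poly f"
  shows "eval_one (fls_const c * f) = c * eval_one f"
  using assms unfolding laurent_poly_def sum_distrib_left eval_one_def [of f]
  by (subst eval_one_eq [where T = "{m. fls_nth f m \<noteq> 0}"]) (auto simp: sum_distrib_left)

lemma fls_support_shift: "{m. fls_nth (fls_shift k f) m \<noteq> 0} = (\<lambda>m. m - k) ` {m. fls_nth f m \<noteq> 0}"
proof -
  have "m \<in> (\<lambda>m. m - k) ` {m. fls_nth f m \<noteq> 0}" if "fls_nth (fls_shift k f) m \<noteq> 0" for m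
    using that by (intro image_eqI [of _ _ "m + k"]) auto
  thus ?thesis by auto
qed

lemma laurent_poly_shift: "laurent_poly f \<Longrightarrow> laurent_poly (fls_shift k f)"
  unfolding laurent_poly_def fls_support_shift by (rule finite_imageI)

lemma eval_one_shift: "eval_one (fls_shift k f) = eval_one f"
  unfolding eval_one_def fls_support_shift by (subst sum.reindex) (auto simp: inj_on_def)

lemma laurent_poly_1: "laurent_poly 1"
  by (simp add: laurent_poly_def)

lemma eval_one_1: "eval_one (1 :: 'a::comm_ring_1 fls) = 1"
  by (subst eval_one_eq [where T = "{0}"]) auto

lemma laurent_poly_0: "laurent_poly 0" and eval_one_0: "eval_one 0 = 0"
  by (simp_all add: laurent_poly_def eval_one_def)

lemma laurent_poly_sum:
  fixes f :: "'b \<Rightarrow> 'a::comm_ring_1 fls"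
  assumes "\<And>i. i \<in> S \<Longrightarrow> laurent_poly (f i)"
  shows "laurent_poly (sum f S)" "eval_one (sum f S) = (\<Sum>i\<in>S. eval_one (f i))"
proof -
  have "laurent_poly (sum f S) \<and> eval_one (sum f S) = (\<Sum>i\<in>S. eval_one (f i))"
    using assms
    by (induction S rule: infinite_finite_induct)
       (auto simp: laurent_poly_0 eval_one_0 laurent_poly_add eval_one_add)
  thus "laurent_poly (sum f S)" "eval_one (sum f S) = (\<Sum>i\<in>S. eval_one (f i))" by auto
qed

text \<open>Writing a product as a finite combination of shifts of \<open>g\<close> reduces
  multiplicativity of \<open>eval_one\<close> to linearity and invariance under shifts.\<close>

lemma laurent_poly_expand:
  fixes f :: "'a::comm_ring_1 fls"
  assumes "laurent_poly f"
  shows "f * g = (\<Sum>m | fls_nth f m \<noteq> 0. fls_const (fls_nth f m) * fls_shift (- m) g)"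
proof -
  have nth: "fls_nth (sum h S) k = (\<Sum>i\<in>S. fls_nth (h i) k)" for h :: "int \<Rightarrow> 'a fls" and S k
    by (induction S rule: infinite_finite_induct) auto
  have "f = (\<Sum>m | fls_nth f m \<noteq> 0. fls_const (fls_nth f m) * fls_X_intpow m)"
  proof (rule fls_eqI)
    fix k
    show "fls_nth f k = fls_nth (\<Sum>m | fls_nth f m \<noteq> 0. fls_const (fls_nth f m) * fls_X_intpow m) k"
      using assms unfolding nth laurent_poly_def
      by (cases "fls_nth f k = 0") (auto simp: if_distrib [of "(*) _"] sum.delta cong: if_cong)
  qed
  hence "f * g = (\<Sum>m | fls_nth f m \<noteq> 0. fls_const (fls_nth f m) * fls_X_intpow m) * g"
    by (rule arg_cong [where f = "\<lambda>h. h * g"])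
  thus ?thesis unfolding sum_distrib_right mult.assoc unfolding fls_X_intpow_times_conv_shift(1) .
qed

lemma laurent_poly_mult:
  fixes f g :: "'a::comm_ring_1 fls"
  assumes "laurent_poly f" "laurent_poly g"
  shows "laurent_poly (f * g)" "eval_one (f * g) = eval_one f * eval_one g"
  unfolding laurent_poly_expand [OF assms(1)]
  using assms(2)
  by (simp_all add: laurent_poly_sum laurent_poly_const_mult laurent_poly_shift
      eval_one_const_mult eval_one_shift sum_distrib_right [symmetric]) (simp add: eval_one_def)

text \<open>The Euler operator \<open>z d/dz\<close>. It multiplies the coefficient of
  \<open>z^m\<close> by \<open>m\<close>, so applying it twice and setting \<open>z = 1\<close>
  yields second moments.\<close>

definition fls_theta :: "'a::comm_ring_1 fls \<Rightarrow> 'a fls" where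
  "fls_theta f = fls_X * fls_deriv f"

lemma fls_theta_nth: "fls_nth (fls_theta f) m = of_int m * fls_nth f m"
  by (simp add: fls_theta_def fls_X_times_conv_shift)

lemma fls_theta_mult: "fls_theta (f * g) = fls_theta f * g + f * fls_theta g"
  by (simp add: fls_theta_def algebra_simps)

lemma laurent_poly_theta: "laurent_poly f \<Longrightarrow> laurent_poly (fls_theta f)"
  unfolding laurent_poly_def by (erule finite_subset [rotated]) (auto simp: fls_theta_nth)

definition laurent_fps :: "'a::comm_ring_1 fls fps \<Rightarrow> bool" where
  "laurent_fps F \<longleftrightarrow> (\<forall>n. laurent_poly (fps_nth F n))"

definition fps_eval_one :: "'a::comm_ring_1 fls fps \<Rightarrow> 'a fps" where
  "fps_eval_one F = Abs_fps (\<lambda>n. eval_one (fps_nth F n))"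

definition fps_theta :: "'a::comm_ring_1 fls fps \<Rightarrow> 'a fls fps" where
  "fps_theta F = Abs_fps (\<lambda>n. fls_theta (fps_nth F n))"

lemma laurent_fps_add: "laurent_fps F \<Longrightarrow> laurent_fps G \<Longrightarrow> laurent_fps (F + G)"
  by (simp add: laurent_fps_def laurent_poly_add)

lemma fps_eval_one_add: "laurent_fps F \<Longrightarrow> laurent_fps G \<Longrightarrow> fps_eval_one (F + G) = fps_eval_one F + fps_eval_one G"
  by (rule fps_ext) (simp add: laurent_fps_def fps_eval_one_def eval_one_add)

lemma laurent_fps_mult: "laurent_fps F \<Longrightarrow> laurent_fps G \<Longrightarrow> laurent_fps (F * G)"
  unfolding laurent_fps_def fps_mult_nth by (intro allI laurent_poly_sum laurent_poly_mult) auto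

lemma fps_eval_one_mult: "laurent_fps F \<Longrightarrow> laurent_fps G \<Longrightarrow> fps_eval_one (F * G) = fps_eval_one F * fps_eval_one G"
  by (rule fps_ext)
     (simp add: laurent_fps_def fps_eval_one_def fps_mult_nth laurent_poly_sum laurent_poly_mult)

lemma laurent_fps_theta: "laurent_fps F \<Longrightarrow> laurent_fps (fps_theta F)"
  by (simp add: laurent_fps_def fps_theta_def laurent_poly_theta)

lemma fls_theta_sum: "fls_theta (sum f S) = (\<Sum>i\<in>S. fls_theta (f i))"
  by (induction S rule: infinite_finite_induct) (simp_all add: fls_theta_def distrib_left)

lemma fps_theta_add: "fps_theta (F + G) = fps_theta F + fps_theta G"
  by (rule fps_ext) (simp add: fps_theta_def fls_theta_def distrib_left)

lemma fps_theta_mult: "fps_theta (F * G) = fps_theta F * G + F * fps_theta G"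
  by (rule fps_ext)
     (simp add: fps_theta_def fps_mult_nth fls_theta_sum fls_theta_mult sum.distrib)

lemma fps_theta_theta_mult:
  "fps_theta (fps_theta (F * G)) = fps_theta (fps_theta F) * G + 2 * (fps_theta F * fps_theta G) + F * fps_theta (fps_theta G)"
  by (simp add: fps_theta_mult fps_theta_add)

text \<open>Solving \<open>F * inverse F = 1\<close> for coefficient \<open>n\<close> of the inverse
  involves no division, because the constant term of \<open>F\<close> is 1; polynomiality is thus
  inherited from lower coefficients.\<close>

lemma laurent_fps_inverse:
  fixes F :: "'a::field fls fps"
  assumes "laurent_fps F" "fps_nth F 0 = 1"
  shows "laurent_fps (inverse F)"
  unfolding laurent_fps_def
proof
  fix n
  show "laurent_poly (fps_nth (inverse F) n)"
  proof (induction n rule: less_induct)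
    case (less n)
    show ?case
    proof (cases "n = 0")
      case True
      thus ?thesis using assms by (simp add: laurent_poly_1)
    next
      case False
      have "F * inverse F = 1" using assms by (simp add: inverse_mult_eq_1')
      hence "0 = fps_nth (F * inverse F) n" using False by simp
      also have "\<dots> = fps_nth (inverse F) n + (\<Sum>i=1..n. fps_nth F i * fps_nth (inverse F) (n - i))"
        unfolding fps_mult_nth using assms by (simp add: sum.atLeast_Suc_atMost)
      finally have "fps_nth (inverse F) n = - (\<Sum>i=1..n. fps_nth F i * fps_nth (inverse F) (n - i))"
        by (simp only: eq_neg_iff_add_eq_0)
      also have "\<dots> = fls_const (- 1) * (\<Sum>i=1..n. fps_nth F i * fps_nth (inverse F) (n - i))"
        by (rule fls_eqI) simp
      finally have "fps_nth (inverse F) n = fls_const (- 1) * (\<Sum>i=1..n. fps_nth F i * fps_nth (inverse F) (n - i))" .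
      moreover have "laurent_poly (\<Sum>i=1..n. fps_nth F i * fps_nth (inverse F) (n - i))"
        using assms(1) less by (intro laurent_poly_sum laurent_poly_mult) (auto simp: laurent_fps_def)
      ultimately show ?thesis by (simp only: laurent_poly_const_mult)
    qed
  qed
qed


section \<open>The crank product and its derivatives at z = 1\<close>

definition fps_monomial :: "'a::comm_ring_1 fls \<Rightarrow> nat \<Rightarrow> 'a fls fps" where
  "fps_monomial c k = fps_const c * fps_X ^ k"

lemma fps_nth_monomial: "fps_nth (fps_monomial c k) n = (if n = k then c else 0)"
  by (simp add: fps_monomial_def fps_X_power_nth)

lemma laurent_fps_monomial: "laurent_poly c \<Longrightarrow> laurent_fps (fps_monomial c k)"
  by (simp add: laurent_fps_def fps_nth_monomial laurent_poly_0)

lemma fps_eval_one_monomial: "fps_eval_one (fps_monomial c k) = fps_const (eval_one c) * fps_X ^ k"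
  by (rule fps_ext) (simp add: fps_eval_one_def fps_nth_monomial eval_one_0 fps_X_power_nth)

lemma fps_theta_monomial: "fps_theta (fps_monomial c k) = fps_monomial (fls_theta c) k"
  by (rule fps_ext) (simp add: fps_theta_def fps_nth_monomial fls_theta_def)

definition crank_denom_factor :: "nat \<Rightarrow> complex fls fps" where
  "crank_denom_factor k = (1 - fps_const fls_X * fps_X ^ k) * (1 - fps_const fls_X_inv * fps_X ^ k)"

text \<open>The factor is \<open>1 - (z + 1/z) X^k + X^(2k)\<close>. By its symmetry in
  \<open>z\<close> and \<open>1/z\<close> the first derivative vanishes at \<open>z = 1\<close>,
  while \<open>(z d/dz)^2\<close> turns it into \<open>- (z + 1/z) X^k\<close>.\<close>

lemma crank_denom_factor_moments:
  "laurent_fps (crank_denom_factor k)"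
  "fps_eval_one (crank_denom_factor k) = (1 - fps_X ^ k)\<^sup>2"
  "fps_eval_one (fps_theta (crank_denom_factor k)) = 0"
  "fps_eval_one (fps_theta (fps_theta (crank_denom_factor k))) = - 2 * fps_X ^ k"
proof -
  define x y :: "complex fls" where "x = fls_const (- 1) * fls_shift (- 1) 1" and "y = fls_const (- 1) * fls_shift 1 1"
  have xy: "x = - fls_X" "y = - fls_X_inv"
    by (rule fls_eqI; simp add: x_def y_def)+
  have th: "fls_theta x = x" "fls_theta y = fls_const (- 1) * y" "fls_theta (fls_const (- 1) * y) = y"
    "fls_theta (1 :: complex fls) = 0"
  proof -
    have x: "fls_nth x m = (if m = 1 then - 1 else 0)" and y: "fls_nth y m = (if m = - 1 then - 1 else 0)" for m
      by (auto simp: x_def y_def)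
    show "fls_theta x = x" "fls_theta y = fls_const (- 1) * y" "fls_theta (fls_const (- 1) * y) = y"
      by (rule fls_eqI; simp add: fls_theta_nth x y)+
    show "fls_theta (1 :: complex fls) = 0" by (simp add: fls_theta_def)
  qed
  have l: "laurent_poly x" "laurent_poly y"
    unfolding x_def y_def by (intro laurent_poly_const_mult laurent_poly_shift laurent_poly_1)+
  have ev: "eval_one x = - 1" "eval_one y = - 1" "eval_one (fls_const (- 1) * y) = 1"
    using l(2) by (simp_all only: x_def y_def eval_one_const_mult laurent_poly_shift laurent_poly_1
        laurent_poly_const_mult eval_one_shift eval_one_1) simp_all
  have inv: "fls_X * fls_X_inv = (1 :: complex fls)" by (rule fls_eqI) (simp add: fls_X_times_conv_shift)
  have D: "crank_denom_factor k = fps_monomial 1 0 + fps_monomial x k + fps_monomial y k + fps_monomial 1 (2 * k)"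
  proof -
    have "fps_const fls_X * fps_X ^ k * (fps_const fls_X_inv * fps_X ^ k)
        = fps_const (fls_X * fls_X_inv) * (fps_X ^ k * fps_X ^ k :: complex fls fps)"
      by (simp only: fps_const_mult [symmetric] mult_ac)
    also have "\<dots> = fps_monomial 1 (2 * k)" unfolding inv by (simp add: fps_monomial_def mult_2 power_add)
    finally show ?thesis
      unfolding crank_denom_factor_def
      by (simp add: algebra_simps fps_monomial_def xy fps_const_neg [symmetric] del: fps_const_neg)
  qed
  have c: "fps_const (- 1) = (- 1 :: complex fps)" "fps_const 1 = (1 :: complex fps)" "fps_const 0 = (0 :: complex fps)"
    by (rule fps_ext; simp)+
  note lm = laurent_fps_add laurent_fps_monomial laurent_poly_1 l laurent_poly_const_mult laurent_poly_0
  note ev' = fps_eval_one_add fps_eval_one_monomial ev eval_one_1 eval_one_0 lm fps_theta_add fps_theta_monomial th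
  show "laurent_fps (crank_denom_factor k)" unfolding D by (simp only: lm)
  show "fps_eval_one (crank_denom_factor k) = (1 - fps_X ^ k)\<^sup>2"
  proof -
    have "fps_eval_one (crank_denom_factor k) = 1 + (- 1) * fps_X ^ k + (- 1) * fps_X ^ k + (fps_X ^ k)\<^sup>2"
      unfolding D by (simp only: ev' c power_mult [symmetric] mult.commute [of 2] power_0 mult_1)
    also have "\<dots> = (1 - fps_X ^ k)\<^sup>2" by algebra
    finally show ?thesis .
  qed
  have th0: "fls_theta (0 :: complex fls) = 0" by (simp add: fls_theta_def)
  show "fps_eval_one (fps_theta (crank_denom_factor k)) = 0"
    unfolding D by (simp only: ev' c) simp
  show "fps_eval_one (fps_theta (fps_theta (crank_denom_factor k))) = - 2 * fps_X ^ k"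
    unfolding D by (simp only: ev' c th0) simp
qed

lemma fps_eval_one_1: "fps_eval_one 1 = 1" "laurent_fps 1" "fps_theta 1 = 0"
  by (auto simp: fps_eq_iff fps_eval_one_def fps_theta_def laurent_fps_def eval_one_1 eval_one_0
      laurent_poly_1 laurent_poly_0 fls_theta_def fps_one_nth)

text \<open>The mixed term of the second product rule contains first derivatives and vanishes at
  \<open>z = 1\<close>. Each factor therefore contributes additively its own quotient
  \<open>- 2 X^k / (1 - X^k)^2\<close>.\<close>

lemma crank_denom_moments:
  defines "D \<equiv> \<lambda>N. \<Prod>k=1..N. crank_denom_factor k"
  shows "laurent_fps (D N)"
    "fps_eval_one (D N) = (qfac fps_X N)\<^sup>2"
    "fps_eval_one (fps_theta (D N)) = 0"
    "fps_eval_one (fps_theta (fps_theta (D N))) =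
       - 2 * (qfac fps_X N)\<^sup>2 * (\<Sum>k=1..N. fps_X ^ k * inverse ((1 - fps_X ^ k)\<^sup>2))"
proof (induction N)
  case 0
  { case 1 show ?case by (simp add: D_def fps_eval_one_1) }
  { case 2 show ?case by (simp add: D_def fps_eval_one_1) }
  { case 3 show ?case by (simp add: D_def fps_eval_one_1) (simp add: fps_eval_one_def eval_one_0 fps_eq_iff) }
  { case 4 show ?case by (simp add: D_def fps_eval_one_1) (simp add: fps_theta_def fps_eval_one_def fls_theta_def eval_one_0 fps_eq_iff) }
next
  case (Suc N)
  note f = crank_denom_factor_moments [of "Suc N"]
  have DS: "D (Suc N) = D N * crank_denom_factor (Suc N)" by (simp add: D_def)
  note t = laurent_fps_theta laurent_fps_mult laurent_fps_add f(1) Suc(1)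
  { case 1 show ?case unfolding DS by (simp only: t) }
  { case 2 show ?case unfolding DS
      by (simp only: t fps_eval_one_mult f Suc qfac_Suc) (simp add: power_mult_distrib mult_ac del: power_Suc) }
  { case 3 show ?case unfolding DS
      by (simp only: t fps_eval_one_mult fps_eval_one_add fps_theta_mult f Suc) simp }
  { case 4
    interpret qbase "fps_X :: complex fps" by unfold_locales simp
    have "fps_nth ((1 - fps_X ^ Suc N)\<^sup>2) 0 = (1::complex)"
      unfolding fps_power_zeroth by (subst one_minus_power_nth_0) simp_all
    hence "(1 - fps_X ^ Suc N)\<^sup>2 * inverse ((1 - fps_X ^ Suc N)\<^sup>2) = (1 :: complex fps)"
      by (intro inverse_mult_eq_1') simp
    moreover define V :: "complex fps" where "V = inverse ((1 - fps_X ^ Suc N)\<^sup>2)"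
    ultimately have V: "(1 - fps_X ^ Suc N)\<^sup>2 * V = 1" by simp
    have alg: "- 2 * Q\<^sup>2 * T * u\<^sup>2 + Q\<^sup>2 * (- 2 * w) = - 2 * (u * Q)\<^sup>2 * (T + w * V)"
      if "u\<^sup>2 * V = 1" for Q T u w :: "complex fps"
      using that by algebra
    have "fps_eval_one (fps_theta (fps_theta (D (Suc N)))) =
       - 2 * (qfac fps_X N)\<^sup>2 * (\<Sum>k=1..N. fps_X ^ k * inverse ((1 - fps_X ^ k)\<^sup>2)) * (1 - fps_X ^ Suc N)\<^sup>2
        + (qfac fps_X N)\<^sup>2 * (- 2 * fps_X ^ Suc N)"
      unfolding DS by (simp only: t fps_eval_one_mult fps_eval_one_add fps_theta_mult fps_theta_add f Suc) simp
    also have "\<dots> = - 2 * ((1 - fps_X ^ Suc N) * qfac fps_X N)\<^sup>2 *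
       ((\<Sum>k=1..N. fps_X ^ k * inverse ((1 - fps_X ^ k)\<^sup>2)) + fps_X ^ Suc N * V)"
      using V by (rule alg)
    finally show ?case by (simp only: V_def qfac_Suc sum.atLeast_Suc_atMost_Suc_shift [symmetric]) simp }
qed

interpretation X: qbase "fps_X :: 'a::field fps"
  by unfold_locales simp

interpretation X2: qbase "fps_X\<^sup>2 :: 'a::field fps"
  by unfold_locales (simp add: fps_X_power_nth)

text \<open>The numerator of the crank series is free of \<open>z\<close>. In the second claim the
  left \<open>qfac\<close> lives over Laurent series and the right one over the base field.\<close>

lemma qfac_eval_one:
  "laurent_fps (qfac fps_X N :: 'a::field fls fps)" "fps_eval_one (qfac fps_X N) = (qfac fps_X N :: 'a fps)"
  "fps_theta (qfac fps_X N :: 'a fls fps) = 0"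
proof (induction N)
  case 0
  { case 1 show ?case by (simp add: fps_eval_one_1) }
  { case 2 show ?case by (simp add: fps_eval_one_1) }
  { case 3 show ?case by (simp add: fps_eval_one_1) }
next
  case (Suc N)
  have m: "1 - fps_X ^ Suc N = fps_monomial 1 0 + fps_monomial (fls_const (- 1) * 1) (Suc N :: nat)"
    by (rule fps_ext) (auto simp: fps_nth_monomial fps_X_power_nth fps_one_nth simp del: power_Suc)
  have L: "laurent_fps (1 - fps_X ^ Suc N :: 'a fls fps)"
    unfolding m by (intro laurent_fps_add laurent_fps_monomial laurent_poly_const_mult laurent_poly_1)
  have e: "fps_eval_one (1 - fps_X ^ Suc N) = (1 - fps_X ^ Suc N :: 'a fps)"
    unfolding m
    by (subst fps_eval_one_add)
       (simp_all only: fps_eval_one_monomial eval_one_const_mult eval_one_1 laurent_fps_monomial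
          laurent_poly_const_mult laurent_poly_1, simp add: fps_eq_iff fps_X_power_nth)
  have t: "fps_theta (1 - fps_X ^ Suc N :: 'a fls fps) = 0"
  proof -
    have "fls_theta (1 :: 'a fls) = 0" "fls_theta (fls_const (- 1) * 1 :: 'a fls) = 0"
      by (simp_all add: fls_theta_def)
    thus ?thesis unfolding m fps_theta_add fps_theta_monomial by (simp add: fps_monomial_def)
  qed
  { case 1 show ?case unfolding qfac_Suc using L Suc(1) by (rule laurent_fps_mult) }
  { case 2 show ?case unfolding qfac_Suc fps_eval_one_mult [OF L Suc(1)] e Suc(2) .. }
  { case 3 show ?case unfolding qfac_Suc fps_theta_mult t Suc(3) by simp }
qed

lemma qpoch_inf_qfac: "agree N (qpoch_inf q q) (qfac q N)" if "fps_nth q 0 = 0" for q :: "'a::field fps"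
proof -
  have "(\<Prod>k<N. 1 - q * q ^ k) = qfac q N"
    by (induction N) (simp_all add: qfac_Suc mult.commute)
  with qpoch_inf_agree [OF that that, of N] show ?thesis by simp
qed

lemma crank_gf_agree: "agree N crank_gf (qfac fps_X N * inverse (\<Prod>k=1..N. crank_denom_factor k))"
proof -
  let ?D = "\<Prod>k=1..N. crank_denom_factor k"
  define B where "B = qpoch_inf (fps_const fls_X * fps_X) fps_X * qpoch_inf (fps_const fls_X_inv * fps_X) (fps_X :: complex fls fps)"
  have D0: "fps_nth ?D 0 = 1"
    by (induction N) (simp_all add: crank_denom_factor_def fps_mult_nth_0 fps_power_zeroth)
  \<comment> \<open>Stated for every \<open>M\<close>: the case \<open>M = 1\<close> shows that the
    constant term of \<open>B\<close> is nonzero, even if \<open>N = 0\<close>.\<close>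
  have BD: "agree M B (\<Prod>k=1..M. crank_denom_factor k)" for M
  proof -
    have "agree M B ((\<Prod>k<M. 1 - fps_const fls_X * fps_X * fps_X ^ k) * (\<Prod>k<M. 1 - fps_const fls_X_inv * fps_X * fps_X ^ k))"
      unfolding B_def by (intro agree_mult qpoch_inf_agree) auto
    also have "\<dots> = (\<Prod>k=1..M. crank_denom_factor k)"
      unfolding prod.distrib [symmetric]
      by (simp add: prod.atLeast1_atMost_eq crank_denom_factor_def mult.assoc)
    finally show ?thesis .
  qed
  have "fps_nth B 0 \<noteq> 0" using BD [of 1] by (simp add: agree_iff_nth crank_denom_factor_def fps_mult_nth_0)
  hence "B * crank_gf = qpoch_inf fps_X fps_X"
    unfolding crank_gf_def B_def [symmetric]
    by (simp add: fps_divide_unit mult.left_commute inverse_mult_eq_1')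
  moreover have "agree N (B * crank_gf) (?D * crank_gf)" by (intro agree_mult BD agree_refl)
  moreover have "?D * (qfac fps_X N * inverse ?D) = qfac fps_X N"
    using D0 by (simp add: mult.left_commute inverse_mult_eq_1')
  ultimately have "agree N (?D * crank_gf) (?D * (qfac fps_X N * inverse ?D))"
    using qpoch_inf_qfac [of "fps_X :: complex fls fps" N] by (metis agree_sym agree_trans fps_X_nth zero_neq_one)
  moreover have "fps_nth ?D 0 \<noteq> 0" unfolding D0 by simp
  ultimately show ?thesis by (rule agree_mult_cancel [rotated])
qed

text \<open>The product of the truncated crank series \<open>C\<close> and its denominator
  \<open>D\<close> is free of \<open>z\<close>, so \<open>(z d/dz)^2\<close> annihilates it. At
  \<open>z = 1\<close> the mixed term drops out, and a linear equation for the second moment of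
  \<open>C\<close> remains.\<close>

lemma crank_moment2_gf:
  "agree N (qfac fps_X N * Abs_fps crank_moment2) (2 * (\<Sum>k=1..N. fps_X ^ k * inverse ((1 - fps_X ^ k)\<^sup>2)))"
proof -
  define D where "D = (\<Prod>k=1..N. crank_denom_factor k)"
  define C where "C = qfac fps_X N * inverse D"
  define Q where "Q = (qfac fps_X N :: complex fps)"
  define S where "S = (\<Sum>k=1..N. fps_X ^ k * inverse ((1 - fps_X ^ k)\<^sup>2) :: complex fps)"
  note m = crank_denom_moments [of N, folded D_def Q_def S_def]
  have D0: "fps_nth D 0 = 1"
    unfolding D_def by (induction N) (simp_all add: crank_denom_factor_def fps_mult_nth_0 fps_power_zeroth)
  have LC: "laurent_fps C"
    unfolding C_def using m(1) D0 by (intro laurent_fps_mult laurent_fps_inverse qfac_eval_one)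
  have CD: "C * D = qfac fps_X N" using D0 by (simp add: C_def mult.assoc inverse_mult_eq_1)
  have "fps_theta (fps_theta (C * D)) = 0"
    unfolding CD qfac_eval_one(3) by (simp add: fps_theta_def fls_theta_def fps_eq_iff)
  moreover have "fps_eval_one 0 = (0 :: complex fps)"
    by (simp add: fps_eval_one_def eval_one_0 fps_eq_iff)
  ultimately have "0 = fps_eval_one (fps_theta (fps_theta C) * D + (fps_theta C * fps_theta D + fps_theta C * fps_theta D) + C * fps_theta (fps_theta D))"
    by (simp only: fps_theta_theta_mult mult_2)
  also have "\<dots> = fps_eval_one (fps_theta (fps_theta C)) * Q\<^sup>2 + fps_eval_one C * (- 2 * Q\<^sup>2 * S)"
    by (simp only: fps_eval_one_add fps_eval_one_mult laurent_fps_add laurent_fps_mult laurent_fps_theta LC m) simp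
  finally have 1: "0 = fps_eval_one (fps_theta (fps_theta C)) * Q\<^sup>2 + fps_eval_one C * (- 2 * Q\<^sup>2 * S)" .
  have 2: "fps_eval_one C * Q\<^sup>2 = Q"
    using fps_eval_one_mult [OF LC m(1)] unfolding CD m(2) qfac_eval_one Q_def [symmetric] by simp
  have Q0: "Q \<noteq> 0" using X.qfac_nth_0 [of N, where 'a = complex] unfolding Q_def by auto
  have "Q * (Q * fps_eval_one (fps_theta (fps_theta C))) = Q * (2 * S)" using 1 2 by algebra
  hence eq: "Q * fps_eval_one (fps_theta (fps_theta C)) = 2 * S" using Q0 by simp
  have "agree N (Abs_fps crank_moment2) (fps_eval_one (fps_theta (fps_theta C)))"
    unfolding agree_iff_nth
  proof (intro allI impI)
    fix n assume "n < N"
    hence "fps_nth crank_gf n = fps_nth C n"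
      using crank_gf_agree [of N] by (simp add: agree_iff_nth C_def D_def)
    hence cc: "of_int (m\<^sup>2) * crank_count m n = fls_nth (fls_theta (fls_theta (fps_nth C n))) m" for m
      by (simp add: crank_count_def fls_theta_nth power2_eq_square)
    let ?f = "fls_theta (fls_theta (fps_nth C n))"
    have "finite {m. fls_nth ?f m \<noteq> 0}"
      using LC laurent_poly_theta by (auto simp: laurent_fps_def laurent_poly_def)
    have "crank_moment2 n = (\<Sum>\<^sub>\<infinity>m\<in>{m. fls_nth ?f m \<noteq> 0}. fls_nth ?f m)"
      unfolding crank_moment2_def cc by (rule infsum_cong_neutral) auto
    also have "\<dots> = eval_one ?f"
      unfolding eval_one_def using \<open>finite _\<close> by (rule infsum_finite)
    finally show "fps_nth (Abs_fps crank_moment2) n = fps_nth (fps_eval_one (fps_theta (fps_theta C))) n"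
      by (simp add: fps_eval_one_def fps_theta_def)
  qed
  hence "agree N (Q * Abs_fps crank_moment2) (Q * fps_eval_one (fps_theta (fps_theta C)))"
    by (intro agree_mult agree_refl)
  thus ?thesis unfolding eq unfolding Q_def S_def .
qed

text \<open>Both sides are the double sum of \<open>n X^(n j)\<close>, summed in either order. The
  right form is what index 0 of a Bailey pair produces, the left one is the Lambert series of the
  theorem.\<close>

lemma lambert_agree:
  "agree N (\<Sum>n=1..N. of_nat n * fps_X ^ n * inverse (1 - fps_X ^ n))
     (\<Sum>n=1..N. fps_X ^ n * inverse ((1 - fps_X ^ n)\<^sup>2) :: 'a::field fps)"
proof -
  have geo: "agree N (y * inverse (1 - y)) (\<Sum>j=1..N. y ^ j)"
    and geo2: "agree N (y * inverse ((1 - y)\<^sup>2)) (\<Sum>j=1..N. of_nat j * y ^ j)" if y0: "fps_nth y 0 = 0" for y :: "'a fps"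
  proof -
    have g: "(1 - y) * (\<Sum>j=1..k. y ^ j) = y - y ^ Suc k" for k
    proof (induction k)
      case (Suc k)
      have "(1 - y) * (\<Sum>j=1..Suc k. y ^ j) = (1 - y) * (\<Sum>j=1..k. y ^ j) + (1 - y) * y ^ Suc k"
        by (simp add: sum.cl_ivl_Suc distrib_left del: power_Suc)
      also have "\<dots> = y - y ^ Suc (Suc k)" unfolding Suc by (simp add: algebra_simps)
      finally show ?case .
    qed simp
    have "agree N (y - y ^ Suc N) (y - 0)" using y0 by (intro agree_diff agree_refl agree_power_0) auto
    moreover have "(1 - y) * (y * inverse (1 - y)) = y - 0"
      using y0 by (simp add: mult.left_commute inverse_mult_eq_1')
    ultimately have "agree N ((1 - y) * (y * inverse (1 - y))) ((1 - y) * (\<Sum>j=1..N. y ^ j))"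
      unfolding g by (metis agree_sym)
    thus "agree N (y * inverse (1 - y)) (\<Sum>j=1..N. y ^ j)"
      by (rule agree_mult_cancel [rotated]) (simp add: y0)
    have nz: "fps_nth ((1 - y)\<^sup>2) 0 = 1" using y0 by (simp add: fps_power_zeroth)
    have g2: "(1 - y)\<^sup>2 * (\<Sum>j=1..k. of_nat j * y ^ j) = y - of_nat (Suc k) * y ^ Suc k + of_nat k * y ^ (k + 2)" for k
      by (induction k) (simp_all add: algebra_simps power2_eq_square)
    have "agree N (y - of_nat (Suc N) * y ^ Suc N + of_nat N * y ^ (N + 2)) (y - of_nat (Suc N) * 0 + of_nat N * 0)"
      using y0 by (intro agree_diff agree_add agree_mult agree_refl agree_power_0) auto
    moreover have "(1 - y)\<^sup>2 * (y * inverse ((1 - y)\<^sup>2)) = y - of_nat (Suc N) * 0 + of_nat N * 0"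
      using nz by (simp add: mult.left_commute inverse_mult_eq_1')
    ultimately have "agree N ((1 - y)\<^sup>2 * (y * inverse ((1 - y)\<^sup>2))) ((1 - y)\<^sup>2 * (\<Sum>j=1..N. of_nat j * y ^ j))"
      unfolding g2 by (metis agree_sym)
    thus "agree N (y * inverse ((1 - y)\<^sup>2)) (\<Sum>j=1..N. of_nat j * y ^ j)"
      by (rule agree_mult_cancel [rotated]) (simp add: nz)
  qed
  have "agree N (\<Sum>n=1..N. of_nat n * fps_X ^ n * inverse (1 - fps_X ^ n)) (\<Sum>n=1..N. of_nat n * (\<Sum>j=1..N. (fps_X ^ n) ^ j) :: 'a fps)"
    unfolding mult.assoc by (intro agree_sum agree_mult agree_refl geo) auto
  also have "(\<Sum>n=1..N. of_nat n * (\<Sum>j=1..N. (fps_X ^ n) ^ j)) = (\<Sum>j=1..N. \<Sum>n=1..N. of_nat n * (fps_X ^ j) ^ n :: 'a fps)"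
    unfolding sum_distrib_left by (subst sum.swap) (simp add: power_mult [symmetric] mult.commute)
  also have "agree N \<dots> (\<Sum>j=1..N. fps_X ^ j * inverse ((1 - fps_X ^ j)\<^sup>2))"
    by (intro agree_sum agree_sym [OF geo2]) auto
  finally show ?thesis .
qed

section \<open>The two identities\<close>

lemma qpoch_inf_shift:
  fixes a q :: "'a::field fps"
  assumes "fps_nth a 0 = 0" "fps_nth q 0 = 0"
  shows "qpoch_inf a q = (\<Prod>k<n. 1 - a * q ^ k) * qpoch_inf (a * q ^ n) q"
proof (rule agree_ext)
  fix N
  have "agree N (qpoch_inf a q) (\<Prod>k<n + N. 1 - a * q ^ k)"
    by (rule agree_mono [OF qpoch_inf_agree]) (use assms in auto)
  also have "(\<Prod>k<n + N. 1 - a * q ^ k) = (\<Prod>k<n. 1 - a * q ^ k) * (\<Prod>k<N. 1 - a * q ^ n * q ^ k)"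
    by (induction N) (simp_all add: power_add mult_ac)
  also have "agree N \<dots> ((\<Prod>k<n. 1 - a * q ^ k) * qpoch_inf (a * q ^ n) q)"
    using assms by (intro agree_mult agree_refl agree_sym [OF qpoch_inf_agree]) auto
  finally show "agree N (qpoch_inf a q) ((\<Prod>k<n. 1 - a * q ^ k) * qpoch_inf (a * q ^ n) q)" .
qed

lemma qpoch_inf_even_odd:
  "qpoch_inf fps_X fps_X = qpoch_inf (fps_X\<^sup>2) (fps_X\<^sup>2) * qpoch_inf fps_X (fps_X\<^sup>2 :: 'a::field fps)"
proof (rule agree_ext)
  fix N
  let ?q = "fps_X :: 'a fps"
  have "agree N (qpoch_inf ?q ?q) (\<Prod>k<2 * N. 1 - ?q * ?q ^ k)"
    by (rule agree_mono [OF qpoch_inf_agree]) auto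
  also have "(\<Prod>k<2 * N. 1 - ?q * ?q ^ k) = (\<Prod>k<N. 1 - ?q\<^sup>2 * ?q\<^sup>2 ^ k) * (\<Prod>k<N. 1 - ?q * ?q\<^sup>2 ^ k)"
  proof -
    have "(\<Prod>k<2 * N. 1 - q * q ^ k) = (\<Prod>k<N. 1 - q\<^sup>2 * q ^ (2 * k)) * (\<Prod>k<N. 1 - q * q ^ (2 * k))" for q :: "'a fps"
      by (induction N) (simp_all add: power2_eq_square mult_ac)
    thus ?thesis by (simp only: power_mult)
  qed
  also have "agree N \<dots> (qpoch_inf (?q\<^sup>2) (?q\<^sup>2) * qpoch_inf ?q (?q\<^sup>2))"
    by (intro agree_mult agree_sym [OF qpoch_inf_agree]) (auto simp: fps_X_power_nth)
  finally show "agree N (qpoch_inf ?q ?q) (qpoch_inf (?q\<^sup>2) (?q\<^sup>2) * qpoch_inf ?q (?q\<^sup>2))" .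
qed

lemma qpoch_inf_nth_0:
  "fps_nth a 0 = 0 \<Longrightarrow> fps_nth q 0 = 0 \<Longrightarrow> fps_nth (qpoch_inf a q) 0 = (1 :: 'a::field)"
  using qpoch_inf_agree [of a q 1] by (simp add: agree_iff_nth)

text \<open>Since \<open>(q^(2n+1); q^2)_\<infinity> = (q; q^2)_\<infinity> / (q; q^2)_n\<close> and
  \<open>(q^(n+1); q)_\<infinity> = (q)_\<infinity> / (q)_n\<close>, the infinite products combine
  to \<open>1 / (q^2; q^2)_\<infinity>\<close>. The variable \<open>r\<close> stands for the power
  of \<open>q\<close>, the only point where the two series differ.\<close>

lemma summand_eq:
  fixes q :: "'a::field fps"
  defines "q \<equiv> fps_X"
  assumes n: "0 < n"
  shows "r * qpoch_inf (q ^ (2 * n + 1)) (q\<^sup>2) / ((1 - q ^ n)\<^sup>2 * qpoch_inf (q ^ (n + 1)) q) =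
    inverse (qpoch_inf (q\<^sup>2) (q\<^sup>2)) * (r * (qfac q (n - 1))\<^sup>2 * X.slater_beta n)"
proof -
  define W where "W = qpoch_inf (q ^ (2 * n + 1)) (q\<^sup>2)"
  define V where "V = qpoch_inf (q ^ (n + 1)) q"
  define P where "P = qpoch_inf (q\<^sup>2) (q\<^sup>2)"
  define K where "K = (\<Prod>k<n. 1 - q ^ (2 * k + 1))"
  define Q where "Q = qfac q n"
  define R where "R = qfac q (n - 1)"
  define u where "u = 1 - q ^ n"
  have q0: "fps_nth q 0 = 0" "fps_nth (q\<^sup>2) 0 = 0" by (simp_all add: q_def fps_X_power_nth)
  have nth: "fps_nth W 0 = 1" "fps_nth V 0 = 1" "fps_nth P 0 = 1" "fps_nth K 0 = 1" "fps_nth Q 0 = 1" "fps_nth u 0 = 1"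
    using n q0
    by (simp_all only: W_def V_def P_def Q_def u_def K_def q_def X.odd_prod_nth_0 X.qfac_nth_0 X.one_minus_power_nth_0)
       (simp_all add: qpoch_inf_nth_0 fps_X_power_nth)
  have QR: "Q = u * R" using n unfolding Q_def R_def u_def by (metis Suc_pred' qfac_Suc)
  have "(\<Prod>k<n. 1 - q * (q\<^sup>2) ^ k) = K" unfolding K_def by (simp add: power_mult [symmetric])
  moreover have "q * (q\<^sup>2) ^ n = q ^ (2 * n + 1)" by (simp add: power_mult [symmetric])
  ultimately have KW: "qpoch_inf q (q\<^sup>2) = K * W" using qpoch_inf_shift [of q "q\<^sup>2" n] q0 by (simp only: W_def)
  have "(\<Prod>k<n. 1 - q * q ^ k) = Q" unfolding Q_def by (induction n) (simp_all add: qfac_Suc mult.commute)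
  hence QV: "qpoch_inf q q = Q * V" using qpoch_inf_shift [of q q n] q0 by (simp add: V_def)
  have main: "Q * V = P * (K * W)"
    using qpoch_inf_even_odd [where 'a = 'a] unfolding q_def [symmetric] KW QV P_def .
  have b: "X.slater_beta n = inverse (Q * K)" unfolding X.slater_beta_def Q_def K_def q_def ..
  define t where "t = r * W / (u\<^sup>2 * V)"
  define s where "s = inverse P * (r * R\<^sup>2 * inverse (Q * K))"
  have "fps_nth (u\<^sup>2 * V) 0 = 1" using nth by (simp add: fps_mult_nth_0 fps_power_zeroth)
  hence t: "t * (u\<^sup>2 * V) = r * W" by (simp add: t_def fps_divide_unit mult.assoc inverse_mult_eq_1)
  have "inverse P * P = 1" "inverse (Q * K) * (Q * K) = 1" using nth by (simp_all add: inverse_mult_eq_1)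
  hence s: "s * (P * (Q * K)) = r * R\<^sup>2" unfolding s_def by algebra
  have "t * (u\<^sup>2 * V * (P * (Q * K))) = s * (u\<^sup>2 * V * (P * (Q * K)))"
    using t s main QR by algebra
  moreover have "u\<^sup>2 * V * (P * (Q * K)) \<noteq> 0" using nth by auto
  ultimately have "t = s" by simp
  thus ?thesis unfolding t_def s_def W_def V_def P_def u_def b R_def .
qed

section \<open>The substitution of q^2 for q\<close>

lemma agree_compose_X2:
  fixes f g :: "'a::field fps"
  assumes "agree N f g"
  shows "agree N (f oo fps_X\<^sup>2) (g oo fps_X\<^sup>2)"
proof -
  obtain h where h: "f - g = fps_X ^ N * h" using assms by (auto simp: agree_def dvd_def)
  have "(f oo fps_X\<^sup>2) - (g oo fps_X\<^sup>2) = (fps_X ^ N * h) oo fps_X\<^sup>2"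
    unfolding h [symmetric] by (simp add: fps_compose_sub_distrib)
  also have "\<dots> = (fps_X\<^sup>2) ^ N * (h oo fps_X\<^sup>2)"
    by (simp add: fps_compose_mult_distrib fps_compose_power [symmetric] fps_X_power_nth)
  also have "agree N \<dots> (0 * (h oo fps_X\<^sup>2))"
    by (intro agree_mult agree_refl agree_power_0) (auto simp: fps_X_power_nth)
  finally show ?thesis by (simp add: agree_def)
qed

lemma infsum_X2_eq_compose:
  fixes f :: "nat \<Rightarrow> 'a::field"
  assumes "f 0 = 0"
  shows "(\<Sum>\<^sub>\<infinity>n\<in>{1..}. fps_const (f n) * fps_X ^ (2 * n)) = Abs_fps f oo fps_X\<^sup>2"
proof (rule agree_ext)
  fix N
  have X2: "(fps_X ^ n oo fps_X\<^sup>2) = (fps_X ^ (2 * n) :: 'a fps)" for n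
    by (simp add: fps_compose_power [symmetric] fps_X_power_nth power_mult)
  have "agree N (\<Sum>\<^sub>\<infinity>n\<in>{1..}. fps_const (f n) * fps_X ^ (2 * n)) (\<Sum>n=1..N. fps_const (f n) * fps_X ^ (2 * n))"
  proof (rule agree_infsum)
    fix n
    have "agree n (fps_const (f n) * fps_X ^ (2 * n)) (fps_const (f n) * 0)"
      by (intro agree_mult agree_refl agree_power_0) auto
    thus "agree n (fps_const (f n) * fps_X ^ (2 * n)) 0" by simp
  qed
  also have "(\<Sum>n=1..N. fps_const (f n) * fps_X ^ (2 * n)) = (\<Sum>n=1..N. fps_const (f n) * fps_X ^ n) oo fps_X\<^sup>2"
    by (simp add: fps_compose_sum_distrib fps_compose_mult_distrib fps_X_power_nth X2)
  also have "agree N \<dots> (Abs_fps f oo fps_X\<^sup>2)"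
  proof (rule agree_compose_X2, unfold agree_iff_nth, intro allI impI)
    fix k assume "k < N"
    have "(\<Sum>n=1..N. f n * (if k = n then 1 else 0)) = (\<Sum>n\<in>{1..N}. if k = n then f n else 0)"
      by (intro sum.cong) auto
    also have "\<dots> = f k" using assms \<open>k < N\<close> by (cases "k = 0") auto
    finally show "fps_nth (\<Sum>n=1..N. fps_const (f n) * fps_X ^ n) k = fps_nth (Abs_fps f) k"
      by (simp add: fps_sum_nth fps_X_power_nth)
  qed
  finally show "agree N (\<Sum>\<^sub>\<infinity>n\<in>{1..}. fps_const (f n) * fps_X ^ (2 * n)) (Abs_fps f oo fps_X\<^sup>2)" .
qed

lemma agree_0_power_mult: "n \<le> m \<Longrightarrow> agree n (fps_X ^ m * h) 0"
  by (auto simp: agree_def intro: dvd_mult2 le_imp_power_dvd)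

lemma qfac_compose_X2: "qfac fps_X N oo fps_X\<^sup>2 = (qfac (fps_X\<^sup>2) N :: 'a::field fps)"
  unfolding qfac_def
  by (simp add: fps_compose_prod_distrib fps_X_power_nth fps_compose_sub_distrib fps_compose_power [symmetric])

lemma compose_X2_summand:
  assumes "0 < n"
  shows "fps_X ^ m * g * inverse ((1 - fps_X ^ n)\<^sup>2) oo fps_X\<^sup>2
     = fps_X ^ (2 * m) * (g oo fps_X\<^sup>2) * inverse ((1 - fps_X ^ (2 * n))\<^sup>2 :: 'a::field fps)"
proof -
  have X2: "(fps_X ^ n oo fps_X\<^sup>2) = (fps_X ^ (2 * n) :: 'a fps)" for n
    by (simp add: fps_compose_power [symmetric] fps_X_power_nth power_mult)
  have nz: "fps_nth ((1 - fps_X ^ n)\<^sup>2 :: 'a fps) 0 \<noteq> 0"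
    using X.one_minus_power_nth_0 [OF assms, where 'a = 'a] by (simp only: fps_power_zeroth power_one) simp
  have inv: "inverse ((1 - fps_X ^ n)\<^sup>2) oo fps_X\<^sup>2 = inverse ((1 - fps_X ^ (2 * n))\<^sup>2 :: 'a fps)"
  proof -
    have X0: "fps_nth (fps_X\<^sup>2) 0 = (0 :: 'a)" by (simp add: fps_X_power_nth)
    have "((1 - fps_X ^ n)\<^sup>2 oo fps_X\<^sup>2) = ((1 - fps_X ^ (2 * n))\<^sup>2 :: 'a fps)"
      unfolding fps_compose_power [OF X0, symmetric] fps_compose_sub_distrib fps_compose_1
      by (simp only: fps_compose_power [OF X0] X2)
    thus ?thesis using fps_inverse_compose [OF X0 nz] by simp
  qed
  show ?thesis by (simp add: fps_compose_mult_distrib fps_X_power_nth X2 inv)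
qed

text \<open>The substitution doubles the exponents:
  \<open>2 (r (3 r - 1) / 2 + r) = r (3 r - 1) + 2 r\<close>. The result is \<open>- 2\<close> times
  the sum that C(1) contributes.\<close>

lemma rank_moment2_gf_X2:
  "agree N (qpoch_inf (fps_X\<^sup>2) (fps_X\<^sup>2) * (\<Sum>\<^sub>\<infinity>n\<in>{1..}. of_int (rank_moment2 n) * fps_X ^ (2 * n)))
    (- 2 * (\<Sum>r=1..N. (-1) ^ r * fps_X ^ (r * (3 * r - 1)) * (1 + fps_X ^ (2 * r))
       * (fps_X ^ (2 * r) * inverse ((1 - fps_X ^ (2 * r))\<^sup>2))) :: 'a::field fps)"
proof -
  have m0: "of_int (rank_moment2 0) = (0 :: 'a)"
    using rank_moment2_eq [of 0 0] by simp
  have X2: "(fps_X ^ n oo fps_X\<^sup>2) = (fps_X ^ (2 * n) :: 'a fps)" for n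
    by (simp add: fps_compose_power [symmetric] fps_X_power_nth power_mult)
  let ?M = "Abs_fps (\<lambda>n. of_int (rank_moment2 n)) :: 'a fps"
  have inf: "(\<Sum>\<^sub>\<infinity>n\<in>{1..}. of_int (rank_moment2 n) * fps_X ^ (2 * n)) = ?M oo fps_X\<^sup>2"
    using infsum_X2_eq_compose [of "\<lambda>n. of_int (rank_moment2 n) :: 'a"] m0 by (simp add: fps_of_int)
  have "agree N (qpoch_inf (fps_X\<^sup>2) (fps_X\<^sup>2) * (?M oo fps_X\<^sup>2)) (qfac (fps_X\<^sup>2) N * (?M oo fps_X\<^sup>2))"
    by (intro agree_mult agree_refl qpoch_inf_qfac) (simp add: fps_X_power_nth)
  also have "\<dots> = (qfac fps_X N * ?M) oo fps_X\<^sup>2"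
    by (simp add: fps_compose_mult_distrib fps_X_power_nth qfac_compose_X2)
  also have "agree N \<dots> ((2 * (\<Sum>n=1..N. - ((-1) ^ n * (fps_X ^ (rank_exponent n + n) * (1 + fps_X ^ n)
        * inverse ((1 - fps_X ^ n)\<^sup>2))))) oo fps_X\<^sup>2)"
    by (rule agree_compose_X2 [OF rank_moment2_gf])
  also have "\<dots> = 2 * (\<Sum>n=1..N. - ((-1) ^ n * (fps_X ^ (2 * (rank_exponent n + n)) * (1 + fps_X ^ (2 * n))
        * inverse ((1 - fps_X ^ (2 * n))\<^sup>2))))"
  proof -
    have X0: "fps_nth (fps_X\<^sup>2) 0 = (0 :: 'a)" by (simp add: fps_X_power_nth)
    have two: "(2 oo fps_X\<^sup>2) = (2 :: 'a fps)" by (simp add: numeral_fps_const)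
    have sign: "((-1) ^ n oo fps_X\<^sup>2) = ((-1) ^ n :: 'a fps)" for n
      by (cases "even n") (simp_all add: fps_compose_uminus)
    have one_plus: "((1 + fps_X ^ n) oo fps_X\<^sup>2) = (1 + fps_X ^ (2 * n) :: 'a fps)" for n
      by (simp only: fps_compose_add_distrib X2 fps_compose_1)
    have "(- ((-1) ^ n * (fps_X ^ (rank_exponent n + n) * (1 + fps_X ^ n) * inverse ((1 - fps_X ^ n)\<^sup>2))) oo fps_X\<^sup>2)
        = - ((-1) ^ n * (fps_X ^ (2 * (rank_exponent n + n)) * (1 + fps_X ^ (2 * n)) * inverse ((1 - fps_X ^ (2 * n))\<^sup>2)) :: 'a fps)"
      if "n \<in> {1..N}" for n
    proof -
      have "0 < n" using that by simp
      thus ?thesis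
        unfolding fps_compose_uminus fps_compose_mult_distrib [OF X0, of "(-1) ^ n"] sign
        by (simp only: compose_X2_summand one_plus)
    qed
    thus ?thesis
      unfolding fps_compose_mult_distrib [OF X0, of 2] two fps_compose_sum_distrib by simp
  qed
  also have "\<dots> = - 2 * (\<Sum>r=1..N. (-1) ^ r * fps_X ^ (r * (3 * r - 1)) * (1 + fps_X ^ (2 * r))
       * (fps_X ^ (2 * r) * inverse ((1 - fps_X ^ (2 * r))\<^sup>2)))"
  proof -
    have "2 * (rank_exponent n + n) = n * (3 * n - 1) + 2 * n" for n
      by (simp only: distrib_left rank_exponent_double)
    thus ?thesis
      unfolding sum_negf by (simp only: power_add mult_minus_right mult_minus_left mult_ac)
  qed
  finally show ?thesis unfolding inf .
qed

lemma crank_moment2_gf_X2: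
  "agree N (qpoch_inf (fps_X\<^sup>2) (fps_X\<^sup>2) * (\<Sum>\<^sub>\<infinity>n\<in>{1..}. fps_const (crank_moment2 n) * fps_X ^ (2 * n)))
    (2 * (\<Sum>k=1..N. fps_X ^ (2 * k) * inverse ((1 - fps_X ^ (2 * k))\<^sup>2)))"
proof -
  have m0: "crank_moment2 0 = 0"
    using crank_moment2_gf [of 1] by (simp add: agree_iff_nth X.qfac_nth_0)
  have inf: "(\<Sum>\<^sub>\<infinity>n\<in>{1..}. fps_const (crank_moment2 n) * fps_X ^ (2 * n)) = Abs_fps crank_moment2 oo fps_X\<^sup>2"
    using m0 by (rule infsum_X2_eq_compose)
  have "agree N (qpoch_inf (fps_X\<^sup>2) (fps_X\<^sup>2) * (Abs_fps crank_moment2 oo fps_X\<^sup>2))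
     (qfac (fps_X\<^sup>2) N * (Abs_fps crank_moment2 oo fps_X\<^sup>2))"
    by (intro agree_mult agree_refl qpoch_inf_qfac) (simp add: fps_X_power_nth)
  also have "\<dots> = (qfac fps_X N * Abs_fps crank_moment2) oo fps_X\<^sup>2"
    by (simp add: fps_compose_mult_distrib fps_X_power_nth qfac_compose_X2)
  also have "agree N \<dots> ((2 * (\<Sum>k=1..N. fps_X ^ k * inverse ((1 - fps_X ^ k)\<^sup>2))) oo fps_X\<^sup>2)"
    by (rule agree_compose_X2 [OF crank_moment2_gf])
  also have "\<dots> = 2 * (\<Sum>k=1..N. fps_X ^ (2 * k) * inverse ((1 - fps_X ^ (2 * k))\<^sup>2))"
  proof -
    have "(2 oo fps_X\<^sup>2) = (2 :: complex fps)" by (simp add: numeral_fps_const)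
    moreover have "fps_nth (fps_X\<^sup>2) 0 = (0 :: complex)" by (simp add: fps_X_power_nth)
    moreover have "(fps_X ^ k * inverse ((1 - fps_X ^ k)\<^sup>2) oo fps_X\<^sup>2)
       = (fps_X ^ (2 * k) * inverse ((1 - fps_X ^ (2 * k))\<^sup>2) :: complex fps)" if "k \<in> {1..N}" for k
      using compose_X2_summand [of k k 1] that by simp
    ultimately show ?thesis
      by (simp add: fps_compose_mult_distrib fps_compose_sum_distrib)
  qed
  finally show ?thesis unfolding inf .
qed

text \<open>Shared by both identities. The power \<open>X^(e n)\<close> is split into the Bailey
  weight \<open>X^n\<close> and a remainder absorbed by \<open>\<beta>\<close>;
  \<open>n \<le> e n\<close> makes the series converge.\<close>

lemma summand_series_agree:
  assumes e: "\<And>n. n \<le> e n"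
    and \<beta>: "\<And>n. fps_X ^ e n * X.slater_beta n = fps_X ^ n * \<beta> n"
    and b: "\<And>n M. n \<le> M \<Longrightarrow> \<beta> n = (qrecip fps_X (int n))\<^sup>2
      + (\<Sum>r=1..M. a r * qrecip fps_X (int n - int (2 * r)) * qrecip fps_X (int n + int (2 * r)))"
  shows "agree N (qpoch_inf (fps_X\<^sup>2) (fps_X\<^sup>2) * (\<Sum>\<^sub>\<infinity>n\<in>{1..}. fps_X ^ e n * qpoch_inf (fps_X ^ (2 * n + 1)) (fps_X\<^sup>2) /
          ((1 - fps_X ^ n)\<^sup>2 * qpoch_inf (fps_X ^ (n + 1)) fps_X)))
    ((\<Sum>n=1..N. fps_X ^ n * inverse ((1 - fps_X ^ n)\<^sup>2))
      + (\<Sum>r=1..N. a r * (fps_X ^ (2 * r) * inverse ((1 - fps_X ^ (2 * r))\<^sup>2))) :: 'a::field fps)"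
    (is "agree N (?P * infsum ?f _) ?R")
proof -
  have P: "fps_nth ?P 0 = 1" by (rule qpoch_inf_nth_0) (simp_all add: fps_X_power_nth)
  have f: "?P * ?f n = fps_X ^ n * (qfac fps_X (n - 1))\<^sup>2 * \<beta> n" if "0 < n" for n
  proof -
    have "?P * ?f n = ?P * inverse ?P * (fps_X ^ e n * (qfac fps_X (n - 1))\<^sup>2 * X.slater_beta n)"
      unfolding summand_eq [OF that] by (simp only: mult_ac)
    also have "\<dots> = (qfac fps_X (n - 1))\<^sup>2 * (fps_X ^ e n * X.slater_beta n)"
      using P by (simp add: inverse_mult_eq_1' mult_ac)
    finally show ?thesis unfolding \<beta> by (simp only: mult_ac)
  qed
  have "agree n (?f n) 0" for n
  \<comment> \<open>At \<open>n = 0\<close> the summand has denominator 0, but a congruence modulo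
    \<open>X^0\<close> says nothing.\<close>
  proof (cases "n = 0")
    case False
    have "?f n = fps_X ^ e n * (inverse ?P * ((qfac fps_X (n - 1))\<^sup>2 * X.slater_beta n))"
      using False by (subst summand_eq) (simp_all add: mult_ac)
    thus ?thesis using agree_0_power_mult [OF e] by simp
  qed (simp add: agree_iff_nth)
  hence "agree N (?P * infsum ?f {1..}) (?P * (\<Sum>n=1..N. ?f n))"
    by (intro agree_mult agree_refl agree_infsum)
  also have "\<dots> = (\<Sum>n=1..N. fps_X ^ n * (qfac fps_X (n - 1))\<^sup>2 * \<beta> n)"
    unfolding sum_distrib_left by (intro sum.cong refl f) simp
  also have "agree N \<dots> ?R"
    by (rule X.bailey_pair_sum [OF _ b]) simp_all
  finally show ?thesis .
qed

lemma lambert_infsum_agree: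
  "agree N (\<Sum>\<^sub>\<infinity>n\<in>{1..}. of_nat n * fps_X ^ n / (1 - fps_X ^ n))
     (\<Sum>n=1..N. fps_X ^ n * inverse ((1 - fps_X ^ n)\<^sup>2) :: 'a::field fps)"
proof -
  have eq: "of_nat n * fps_X ^ n / (1 - fps_X ^ n) = (of_nat n * fps_X ^ n * inverse (1 - fps_X ^ n) :: 'a fps)"
    if "0 < n" for n
    using that by (intro fps_divide_unit) simp
  have "agree N (\<Sum>\<^sub>\<infinity>n\<in>{1..}. of_nat n * fps_X ^ n / (1 - fps_X ^ n))
     (\<Sum>n=1..N. of_nat n * fps_X ^ n / (1 - fps_X ^ n) :: 'a fps)"
  proof (rule agree_infsum)
    fix n
    show "agree n (of_nat n * fps_X ^ n / (1 - fps_X ^ n) :: 'a fps) 0"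
    proof (cases "n = 0")
      case False
      have "of_nat n * fps_X ^ n / (1 - fps_X ^ n) = (fps_X ^ n * (of_nat n * inverse (1 - fps_X ^ n)) :: 'a fps)"
        using False by (simp add: eq mult_ac)
      thus ?thesis by (simp only: agree_0_power_mult order_refl)
    qed simp
  qed
  also have "(\<Sum>n=1..N. of_nat n * fps_X ^ n / (1 - fps_X ^ n)) = (\<Sum>n=1..N. of_nat n * fps_X ^ n * inverse (1 - fps_X ^ n) :: 'a fps)"
    by (intro sum.cong refl eq) simp
  also note lambert_agree
  finally show ?thesis .
qed

text \<open>In base \<open>X^2\<close> the unit pair has at index \<open>r\<close> the coefficient
  that C(5) has at index \<open>2 r\<close>. Its second member is 0 for \<open>n \<ge> 1\<close>, so
  \<open>bailey_pair_sum\<close> evaluates the C(5) sum.\<close>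

lemma unit_pair_sum:
  "agree N (\<Sum>r=1..N. (-1) ^ r * fps_X ^ (r * (r - 1)) * (1 + fps_X ^ (2 * r))
       * (fps_X ^ (2 * r) * inverse ((1 - fps_X ^ (2 * r))\<^sup>2)))
     (- (\<Sum>k=1..N. fps_X ^ (2 * k) * inverse ((1 - fps_X ^ (2 * k))\<^sup>2)) :: 'a::field fps)"
proof -
  let ?y = "fps_X\<^sup>2 :: 'a fps"
  have y: "?y ^ k = fps_X ^ (2 * k)" for k by (simp add: power_mult)
  have y': "?y ^ (r * (r - 1) div 2) = fps_X ^ (r * (r - 1))" for r
  proof -
    have "even (r * (r - 1))" by (cases "even r") auto
    thus ?thesis unfolding y by simp
  qed
  have "agree N (\<Sum>n=1..N. ?y ^ n * (qfac ?y (n - 1))\<^sup>2 * 0)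
    ((\<Sum>n=1..N. ?y ^ n * inverse ((1 - ?y ^ n)\<^sup>2))
      + (\<Sum>r=1..N. ((-1) ^ r * ?y ^ (r * (r - 1) div 2) * (1 + ?y ^ r)) * (?y ^ (1 * r) * inverse ((1 - ?y ^ (1 * r))\<^sup>2))))"
    by (rule X2.bailey_pair_sum [OF _ X2.unit_bailey_pair [symmetric]]) simp_all
  hence "agree N 0 ((\<Sum>k=1..N. fps_X ^ (2 * k) * inverse ((1 - fps_X ^ (2 * k))\<^sup>2)) +
     (\<Sum>r=1..N. (-1) ^ r * fps_X ^ (r * (r - 1)) * (1 + fps_X ^ (2 * r))
       * (fps_X ^ (2 * r) * inverse ((1 - fps_X ^ (2 * r))\<^sup>2)) :: 'a fps))"
    unfolding y' unfolding y by simp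
  from agree_diff [OF agree_sym [OF this] agree_refl, of "\<Sum>k=1..N. fps_X ^ (2 * k) * inverse ((1 - fps_X ^ (2 * k))\<^sup>2)"]
  show ?thesis by simp
qed

text \<open>Here \<open>l\<close> is the Lambert part and \<open>r\<close> the part from positive
  indices. Eliminating \<open>r\<close> between the congruences for \<open>P * L\<close> and
  \<open>P * M\<close> and cancelling \<open>P\<close> gives the equation.\<close>

lemma moment_identity_of_agree:
  fixes P L \<Lambda> M :: "complex fps" and l r :: "nat \<Rightarrow> complex fps"
  assumes P: "fps_nth P 0 = 1"
    and L: "\<And>N. agree N (P * L) (l N + r N)" and \<Lambda>: "\<And>N. agree N \<Lambda> (l N)" and M: "\<And>N. agree N (P * M) (- 2 * r N)"
  shows "L = 1 / P * \<Lambda> - fps_const (1 / 2) * M"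
proof (rule agree_ext)
  fix N
  have "fps_const (1 / 2) * (- 2 * r N) = - r N"
    by (rule fps_ext) (simp add: numeral_fps_const mult.assoc [symmetric])
  moreover have "agree N (\<Lambda> - fps_const (1 / 2) * (P * M)) (l N - fps_const (1 / 2) * (- 2 * r N))"
    by (intro agree_diff agree_mult agree_refl \<Lambda> M)
  moreover have "P * (1 / P * \<Lambda> - fps_const (1 / 2) * M) = \<Lambda> - fps_const (1 / 2) * (P * M)"
  proof -
    have "P * (1 / P) = 1" using P by (simp add: fps_divide_unit inverse_mult_eq_1')
    thus ?thesis by algebra
  qed
  ultimately have "agree N (P * (1 / P * \<Lambda> - fps_const (1 / 2) * M)) (l N + r N)"
    by (simp only: diff_minus_eq_add)
  hence "agree N (P * L) (P * (1 / P * \<Lambda> - fps_const (1 / 2) * M))"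
    using L agree_sym agree_trans by blast
  thus "agree N L (1 / P * \<Lambda> - fps_const (1 / 2) * M)"
    by (rule agree_mult_cancel [rotated]) (simp add: P)
qed

theorem theorem1:
  "let q = (fps_X :: complex fps) in
     (\<Sum>\<^sub>\<infinity>n\<in>{1..}. q ^ n * qpoch_inf (q ^ (2 * n + 1)) (q\<^sup>2) /
          ((1 - q ^ n)\<^sup>2 * qpoch_inf (q ^ (n + 1)) q)) =
        1 / qpoch_inf (q\<^sup>2) (q\<^sup>2) * (\<Sum>\<^sub>\<infinity>n\<in>{1..}. of_nat n * q ^ n / (1 - q ^ n))
        - fps_const (1 / 2) * (\<Sum>\<^sub>\<infinity>n\<in>{1..}. of_int (rank_moment2 n) * q ^ (2 * n))
   \<and> (\<Sum>\<^sub>\<infinity>n\<in>{1..}. q ^ (n * (n + 1) div 2) * qpoch_inf (q ^ (2 * n + 1)) (q\<^sup>2) /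
          ((1 - q ^ n)\<^sup>2 * qpoch_inf (q ^ (n + 1)) q)) =
        1 / qpoch_inf (q\<^sup>2) (q\<^sup>2) * (\<Sum>\<^sub>\<infinity>n\<in>{1..}. of_nat n * q ^ n / (1 - q ^ n))
        - fps_const (1 / 2) * (\<Sum>\<^sub>\<infinity>n\<in>{1..}. fps_const (crank_moment2 n) * q ^ (2 * n))"
proof -
  define q where "q = (fps_X :: complex fps)"
  have P: "fps_nth (qpoch_inf (q\<^sup>2) (q\<^sup>2)) 0 = 1"
    by (rule qpoch_inf_nth_0) (simp_all add: q_def fps_X_power_nth)
  have "(\<Sum>\<^sub>\<infinity>n\<in>{1..}. q ^ n * qpoch_inf (q ^ (2 * n + 1)) (q\<^sup>2) /
          ((1 - q ^ n)\<^sup>2 * qpoch_inf (q ^ (n + 1)) q)) =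
        1 / qpoch_inf (q\<^sup>2) (q\<^sup>2) * (\<Sum>\<^sub>\<infinity>n\<in>{1..}. of_nat n * q ^ n / (1 - q ^ n))
        - fps_const (1 / 2) * (\<Sum>\<^sub>\<infinity>n\<in>{1..}. of_int (rank_moment2 n) * q ^ (2 * n))"
  proof (rule moment_identity_of_agree [OF P])
    fix N
    show "agree N (qpoch_inf (q\<^sup>2) (q\<^sup>2) * (\<Sum>\<^sub>\<infinity>n\<in>{1..}. q ^ n * qpoch_inf (q ^ (2 * n + 1)) (q\<^sup>2) /
          ((1 - q ^ n)\<^sup>2 * qpoch_inf (q ^ (n + 1)) q)))
       ((\<Sum>n=1..N. q ^ n * inverse ((1 - q ^ n)\<^sup>2)) +
        (\<Sum>r=1..N. (-1) ^ r * q ^ (r * (3 * r - 1)) * (1 + q ^ (2 * r)) * (q ^ (2 * r) * inverse ((1 - q ^ (2 * r))\<^sup>2))))"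
      unfolding q_def
      by (rule summand_series_agree [where \<beta> = X.slater_beta])
         (simp_all only: X.rank_bailey_pair order_refl)
    show "agree N (\<Sum>\<^sub>\<infinity>n\<in>{1..}. of_nat n * q ^ n / (1 - q ^ n)) (\<Sum>n=1..N. q ^ n * inverse ((1 - q ^ n)\<^sup>2))"
      unfolding q_def by (rule lambert_infsum_agree)
    show "agree N (qpoch_inf (q\<^sup>2) (q\<^sup>2) * (\<Sum>\<^sub>\<infinity>n\<in>{1..}. of_int (rank_moment2 n) * q ^ (2 * n)))
       (- 2 * (\<Sum>r=1..N. (-1) ^ r * q ^ (r * (3 * r - 1)) * (1 + q ^ (2 * r)) * (q ^ (2 * r) * inverse ((1 - q ^ (2 * r))\<^sup>2))))"
      unfolding q_def by (rule rank_moment2_gf_X2)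
  qed
  moreover have "(\<Sum>\<^sub>\<infinity>n\<in>{1..}. q ^ (n * (n + 1) div 2) * qpoch_inf (q ^ (2 * n + 1)) (q\<^sup>2) /
          ((1 - q ^ n)\<^sup>2 * qpoch_inf (q ^ (n + 1)) q)) =
        1 / qpoch_inf (q\<^sup>2) (q\<^sup>2) * (\<Sum>\<^sub>\<infinity>n\<in>{1..}. of_nat n * q ^ n / (1 - q ^ n))
        - fps_const (1 / 2) * (\<Sum>\<^sub>\<infinity>n\<in>{1..}. fps_const (crank_moment2 n) * q ^ (2 * n))"
  proof (rule moment_identity_of_agree [OF P])
    fix N
    \<comment> \<open>The summand \<open>n\<close> is the Bailey weight; the other exponent belongs
      to C(5).\<close>
    have tri: "n * (n + 1) div 2 = n + n * (n - 1) div 2" for n :: nat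
    proof -
      have "n * (n + 1) = 2 * n + n * (n - 1)" by (cases n) (simp_all add: algebra_simps)
      thus ?thesis by simp
    qed
    show "agree N (qpoch_inf (q\<^sup>2) (q\<^sup>2) * (\<Sum>\<^sub>\<infinity>n\<in>{1..}. q ^ (n * (n + 1) div 2) * qpoch_inf (q ^ (2 * n + 1)) (q\<^sup>2) /
          ((1 - q ^ n)\<^sup>2 * qpoch_inf (q ^ (n + 1)) q)))
       ((\<Sum>n=1..N. q ^ n * inverse ((1 - q ^ n)\<^sup>2)) +
        (\<Sum>r=1..N. (-1) ^ r * q ^ (r * (r - 1)) * (1 + q ^ (2 * r)) * (q ^ (2 * r) * inverse ((1 - q ^ (2 * r))\<^sup>2))))"
      unfolding q_def
    proof (rule summand_series_agree [where \<beta> = "\<lambda>n. fps_X ^ (n * (n - 1) div 2) * X.slater_beta n"])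
      show "n \<le> n * (n + 1) div 2" for n :: nat unfolding tri by simp
      show "fps_X ^ (n * (n + 1) div 2) * X.slater_beta n = fps_X ^ n * (fps_X ^ (n * (n - 1) div 2) * X.slater_beta n :: complex fps)" for n
        unfolding tri power_add by (simp only: mult.assoc)
    qed (simp only: X.crank_bailey_pair)
    show "agree N (\<Sum>\<^sub>\<infinity>n\<in>{1..}. of_nat n * q ^ n / (1 - q ^ n)) (\<Sum>n=1..N. q ^ n * inverse ((1 - q ^ n)\<^sup>2))"
      unfolding q_def by (rule lambert_infsum_agree)
    \<comment> \<open>The unit pair exchanges the C(5) sum for the sum that the crank moment
      produces.\<close>
    have "agree N (- 2 * (\<Sum>r=1..N. (-1) ^ r * q ^ (r * (r - 1)) * (1 + q ^ (2 * r)) * (q ^ (2 * r) * inverse ((1 - q ^ (2 * r))\<^sup>2))))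
       (- 2 * - (\<Sum>k=1..N. q ^ (2 * k) * inverse ((1 - q ^ (2 * k))\<^sup>2)))"
      unfolding q_def by (intro agree_mult agree_refl unit_pair_sum)
    hence "agree N (2 * (\<Sum>k=1..N. q ^ (2 * k) * inverse ((1 - q ^ (2 * k))\<^sup>2)))
       (- 2 * (\<Sum>r=1..N. (-1) ^ r * q ^ (r * (r - 1)) * (1 + q ^ (2 * r)) * (q ^ (2 * r) * inverse ((1 - q ^ (2 * r))\<^sup>2))))"
      unfolding minus_mult_minus by (rule agree_sym)
    with crank_moment2_gf_X2 [of N, folded q_def]
    show "agree N (qpoch_inf (q\<^sup>2) (q\<^sup>2) * (\<Sum>\<^sub>\<infinity>n\<in>{1..}. fps_const (crank_moment2 n) * q ^ (2 * n)))
       (- 2 * (\<Sum>r=1..N. (-1) ^ r * q ^ (r * (r - 1)) * (1 + q ^ (2 * r)) * (q ^ (2 * r) * inverse ((1 - q ^ (2 * r))\<^sup>2))))"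
      by (rule agree_trans)
  qed
  ultimately show ?thesis unfolding q_def Let_def ..
qed

end
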